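(* For every term $\alpha$ of $\mathrm{OT}$: if $\overline{\mathbb{FC}}(\alpha)=-\infty$ then $\alpha^*=\alpha\in\mathrm{Acc}_{-\infty}$; and if $\overline{\mathbb{FC}}(\alpha)>-\infty$ then $\alpha^*\in\mathrm{Acc}_n$ for every $n\in\mathbb{N}$ with $n\ge-\mathbb{G}(\alpha^* )$. In particular the ordering $<$ restricted to each such set $M_n$ containing $\alpha^*$ is well-founded below $\alpha^*$.
   Context: We work in the "polymorphic" ordinal notation system $\mathrm{OT}$ with distinguished subset $\mathbb{H}$, defined inductively: (i) if $\{\alpha_0,\dots,\alpha_{k-1}\}$ is a finite multiset of terms each in $\mathbb{H}$ and $k\neq 1$, then $\#\{\alpha_0,\dots,\alpha_{k-1}\}$ is a term ($0$ denotes the empty sum); (ii) if $\alpha$ is a term then $\omega^\alpha\in\mathbb{H}$; (iii) for each integer $J\le 0$, $\Omega^{(J)}\in\mathbb{H}$; (iv) if $\alpha$ is a term then $\vartheta\alpha\in\mathbb{H}$. $\mathbb{SC}$ is the set of terms in $\mathbb{H}$ not of the form $\omega^\alpha$. Nested sums are flattened into one multiset, and a term of $\mathbb{H}$ is treated as a one-element sum. Formal cardinalities: $\mathbb{FC}^{\le J}(\#\{\alpha_i\})=\bigcup_i\mathbb{FC}^{\le J}(\alpha_i)$; $\mathbb{FC}^{\le J}(\omega^\alpha)=\mathbb{FC}^{\le J}(\alpha)$; $\mathbb{FC}^{\le J}(\Omega^{(J')})=\{J'-J\}$ if $J'\le J$, $\emptyset$ otherwise; $\mathbb{FC}^{\le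 J}(\vartheta\alpha)=\mathbb{FC}^{\le J-1}(\alpha)$. $\overline{\mathbb{FC}}^{\le J}=\sup\mathbb{FC}^{\le J}$ ($\sup\emptyset=-\infty$); $\mathbb{FC}=\mathbb{FC}^{\le0}$, $\overline{\mathbb{FC}}=\overline{\mathbb{FC}}^{\le 0}$. Shifts ($k\ge 0$): $\#\{\alpha_i\}^{\le J}_{\pm k}=\#\{(\alpha_i)^{\le J}_{\pm k}\}$; $(\omega^\alpha)^{\le J}_{\pm k}=\omega^{\alpha^{\le J}_{\pm k}}$; $(\Omega^{(J')})^{\le J}_{\pm k}=\Omega^{(J'\pm k)}$ if $J'\le J$, else $\Omega^{(J')}$; $(\vartheta\alpha)^{\le J}_{\pm k}=\vartheta(\alpha^{\le J-1}_{\pm k})$. Critical subterms: $K^{<J}\#\{\alpha_i\}=\bigcup_iK^{<J}\alpha_i$; $K^{<J}\omega^\alpha=K^{<J}\alpha$; $K^{<J}\Omega^{(J')}=\{\Omega^{(J'-(J-1))}\}$ if $J'<J$, else $\emptyset$; $K^{<J}\vartheta\alpha=\{(\vartheta\alpha)^{\le 0}_{+(1-J)}\}$ if $\overline{\mathbb{FC}}^{\le 0}(\vartheta\alpha)<J$, else $K^{<J-1}\alpha$. Ordering ($\le$ is $<$ or syntactic identity): $\#\{\alpha_i\}<\#\{\beta_j\}$ iff some $\beta_{j_0}\in\{\beta_j\}\setminus\{\alpha_i\}$ exceeds every $\alpha_i\in\{\alpha_i\}\setminus\{\beta_j\}$ (multiset differences); for $\beta\in\mathbb{H}$: $\beta<\#\{\alpha_i\}$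 iff $\beta\le\alpha_i$ for some $i$, $\#\{\alpha_i\}<\beta$ iff all $\alpha_i<\beta$; $\omega^\alpha<\omega^\beta$ iff $\alpha<\beta$; for $\beta\in\mathbb{SC}$: $\beta<\omega^\alpha$ iff $\beta<\alpha$, $\omega^\alpha<\beta$ iff $\alpha\le\beta$; $\Omega^{(J)}<\Omega^{(J')}$ iff $J<J'$; $\Omega^{(J)}<\vartheta\alpha$ iff some $\beta\in K^{<0}\alpha$ has $\Omega^{(J)}\le\beta$; $\vartheta\alpha<\Omega^{(J)}$ iff all $\beta\in K^{<0}\alpha$ have $\beta<\Omega^{(J)}$; $\vartheta\alpha<\vartheta\beta$ iff ($\alpha<\beta$ and all $\gamma\in K^{<0}\alpha$ have $\gamma<\vartheta\beta$) or ($\beta<\alpha$ and some $\gamma\in K^{<0}\beta$ has $\vartheta\alpha\le\gamma$). $\mathbb{G}(\alpha)=\min\mathbb{FC}(\alpha)$ (or $-\infty$ if empty). $\alpha^*=\alpha$ if $\overline{\mathbb{FC}}(\alpha)=-\infty$, else $\alpha^*=\alpha^{\le0}_{+(-\overline{\mathbb{FC}}(\alpha))}$ (so $\overline{\mathbb{FC}}(\alpha^* )\in\{-\infty,0\}$). Accessible sets: indices $\{-\infty\}\cup\mathbb{N}$ with $-\infty<0<1<\cdots$. $M_{-\infty}$ = terms with $\overline{\mathbb{FC}}=-\infty$. $\mathrm{Acc}_c$ = well-founded part of $(M_c,<)$ (elements of $M_c$ with no infinite $<$-descending sequence in $M_c$ below them). For $n\in\mathbb{N}$, $M_n$ = terms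 $\alpha$ with $\overline{\mathbb{FC}}(\alpha)=0$, $\mathbb{G}(\alpha)\ge-n$, and $\{\beta^*:\beta\in K^{<0}\alpha\}\subseteq\bigcup_{i<n}\mathrm{Acc}_i$.
   Formalization: For β in SC the ordering clauses are corrected to: β<ω^α iff β≤α, and ω^α<β iff α<β; as printed (β<α, α≤β) they give ω^β<β and the infinite descent ϑ0>ω^{ϑ0}>ω^{ω^{ϑ0}}>… in M_{-∞}, so the claim would be false. *)

theory Defs
  imports "HOL-Library.Multiset" "HOL-Library.Option_ord"
begin

(* Raw terms. The notations are the elements of OT below: sums are never singletons,
   never directly nested, and the indices of Omega are \<le> 0. *)
datatype oterm =
    Sum "oterm multiset"
  | Exp oterm              (* omega to the power of a term *)
  | Omega int
  | Theta oterm

inductive_set OT :: "oterm set" and HH :: "oterm set" where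
  "\<lbrakk>\<forall>\<alpha>\<in>#A. \<alpha> \<in> HH; size A \<noteq> 1\<rbrakk> \<Longrightarrow> Sum A \<in> OT"
| "\<alpha> \<in> HH \<Longrightarrow> \<alpha> \<in> OT"
| "\<alpha> \<in> OT \<Longrightarrow> Exp \<alpha> \<in> HH"
| "J \<le> 0 \<Longrightarrow> Omega J \<in> HH"
| "\<alpha> \<in> OT \<Longrightarrow> Theta \<alpha> \<in> HH"

lemma size_in_Sum [termination_simp]:
  assumes "\<alpha> \<in># A"
  shows "size \<alpha> < Suc (size_multiset size A)"
  using assms by (induction A) (auto simp: less_Suc_eq)

lemma size_in_diff:
  assumes "\<alpha> \<in># A - B"
  shows "size \<alpha> \<le> size_multiset size A"
  using size_in_Sum[OF in_diffD[OF assms]] by simp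

declare image_mset_cong [fundef_cong]

fun FC :: "int \<Rightarrow> oterm \<Rightarrow> int set" where
  "FC J (Sum A) = (\<Union>\<alpha>\<in>set_mset A. FC J \<alpha>)"
| "FC J (Exp \<alpha>) = FC J \<alpha>"
| "FC J (Omega J') = (if J' \<le> J then {J' - J} else {})"
| "FC J (Theta \<alpha>) = FC (J - 1) \<alpha>"

(* In int option and nat option, ordered by Option_ord, None is the least element:
   it plays the role of minus infinity. *)
abbreviation minus_inf :: "'a option"  ("-\<infinity>") where
  "-\<infinity> \<equiv> None"

(* FC J \<alpha> is always finite, so its supremum is the maximum when it is nonempty. *)
definition FC_sup :: "int \<Rightarrow> oterm \<Rightarrow> int option" where
  "FC_sup J \<alpha> = (if FC J \<alpha> = {} then -\<infinity> else Some (Max (FC J \<alpha>)))"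

definition GG :: "oterm \<Rightarrow> int option" where
  "GG \<alpha> = (if FC 0 \<alpha> = {} then -\<infinity> else Some (Min (FC 0 \<alpha>)))"

(* The shift amount is a signed integer, so this covers both the +k and the -k shift. *)
fun shift :: "int \<Rightarrow> int \<Rightarrow> oterm \<Rightarrow> oterm" where
  "shift J k (Sum A) = Sum (image_mset (shift J k) A)"
| "shift J k (Exp \<alpha>) = Exp (shift J k \<alpha>)"
| "shift J k (Omega J') = (if J' \<le> J then Omega (J' + k) else Omega J')"
| "shift J k (Theta \<alpha>) = Theta (shift (J - 1) k \<alpha>)"

definition star :: "oterm \<Rightarrow> oterm" where
  "star \<alpha> = (case FC_sup 0 \<alpha> of None \<Rightarrow> \<alpha> | Some s \<Rightarrow> shift 0 (- s) \<alpha>)"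

(* KK J is the operator with superscript "< J". *)
fun KK :: "int \<Rightarrow> oterm \<Rightarrow> oterm set" where
  "KK J (Sum A) = (\<Union>\<alpha>\<in>set_mset A. KK J \<alpha>)"
| "KK J (Exp \<alpha>) = KK J \<alpha>"
| "KK J (Omega J') = (if J' < J then {Omega (J' - (J - 1))} else {})"
| "KK J (Theta \<alpha>) =
    (if FC_sup 0 (Theta \<alpha>) < Some J then {shift 0 (1 - J) (Theta \<alpha>)} else KK (J - 1) \<alpha>)"

lemma size_shift: "size (shift J k \<alpha>) = size \<alpha>"
proof (induction J k \<alpha> rule: shift.induct)
  case (1 J k A)
  then have "size_multiset size (image_mset (shift J k) A) = size_multiset size A"
    by (induction A) auto
  then show ?case by simp
qed auto

lemma size_KK: "\<gamma> \<in> KK J \<alpha> \<Longrightarrow> size \<gamma> \<le> size \<alpha>"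
proof (induction J \<alpha> rule: KK.induct)
  case (1 J A)
  then show ?case using size_in_Sum by fastforce
qed (auto simp: size_shift split: if_splits simp del: shift.simps)

(* Comparing an SC-term \<beta> with a power: \<beta> < omega^\<alpha> iff \<beta> \<le> \<alpha>, and omega^\<alpha> < \<beta> iff \<alpha> < \<beta>.
   With the strict and the non-strict comparison interchanged, which is how the source
   prints these two clauses, one would get omega^\<beta> < \<beta> for every SC-term \<beta>, and hence an
   infinite descending sequence \<beta>, omega^\<beta>, omega^(omega^\<beta>), ...; the two versions differ
   only when \<alpha> and \<beta> are identical. *)
function (sequential) less_ot :: "oterm \<Rightarrow> oterm \<Rightarrow> bool"  (infix "\<prec>" 50) where
  "Sum A \<prec> Sum B \<longleftrightarrow> (\<exists>\<beta>\<in>set_mset (B - A). \<forall>\<alpha>\<in>set_mset (A - B). \<alpha> \<prec> \<beta>)"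
| "\<beta> \<prec> Sum A \<longleftrightarrow> (\<exists>\<alpha>\<in>set_mset A. \<beta> = \<alpha> \<or> \<beta> \<prec> \<alpha>)"
| "Sum A \<prec> \<beta> \<longleftrightarrow> (\<forall>\<alpha>\<in>set_mset A. \<alpha> \<prec> \<beta>)"
| "Exp \<alpha> \<prec> Exp \<beta> \<longleftrightarrow> \<alpha> \<prec> \<beta>"
| "\<beta> \<prec> Exp \<alpha> \<longleftrightarrow> \<beta> = \<alpha> \<or> \<beta> \<prec> \<alpha>"
| "Exp \<alpha> \<prec> \<beta> \<longleftrightarrow> \<alpha> \<prec> \<beta>"
| "Omega J \<prec> Omega J' \<longleftrightarrow> J < J'"
| "Omega J \<prec> Theta \<alpha> \<longleftrightarrow> (\<exists>\<beta>\<in>KK 0 \<alpha>. Omega J = \<beta> \<or> Omega J \<prec> \<beta>)"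
| "Theta \<alpha> \<prec> Omega J \<longleftrightarrow> (\<forall>\<beta>\<in>KK 0 \<alpha>. \<beta> \<prec> Omega J)"
| "Theta \<alpha> \<prec> Theta \<beta> \<longleftrightarrow>
     (\<alpha> \<prec> \<beta> \<and> (\<forall>\<gamma>\<in>KK 0 \<alpha>. \<gamma> \<prec> Theta \<beta>)) \<or>
     (\<beta> \<prec> \<alpha> \<and> (\<exists>\<gamma>\<in>KK 0 \<beta>. Theta \<alpha> = \<gamma> \<or> Theta \<alpha> \<prec> \<gamma>))"
  by pat_completeness auto
termination
  by (relation "measure (\<lambda>(\<alpha>, \<beta>). size \<alpha> + size \<beta>)")
    (auto dest!: size_in_diff dest: size_in_Sum size_KK simp: less_Suc_eq_le)

definition wf_part :: "oterm set \<Rightarrow> oterm set" where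
  "wf_part M = {\<alpha> \<in> M. \<alpha> \<in> Wellfounded.acc {(\<beta>, \<gamma>). \<beta> \<in> M \<and> \<gamma> \<in> M \<and> \<beta> \<prec> \<gamma>}}"

function MM :: "nat option \<Rightarrow> oterm set" where
  "MM -\<infinity> = {\<alpha> \<in> OT. FC_sup 0 \<alpha> = -\<infinity>}"
| "MM (Some n) =
    {\<alpha> \<in> OT. FC_sup 0 \<alpha> = Some 0 \<and> GG \<alpha> \<ge> Some (- int n) \<and>
       star ` KK 0 \<alpha> \<subseteq> (\<Union>i\<in>{..<Some n}. wf_part (MM i))}"
  by pat_completeness auto
termination
  by (relation "{(i, j). i < j}") (auto simp: wf)

definition Acc :: "nat option \<Rightarrow> oterm set" where
  "Acc c = wf_part (MM c)"

end

(* On OT the relation < is a strict linear order, shifts preserve it, and alpha < beta implies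
   that the largest cardinality in alpha is at most the largest one in beta.  Reindex the accessible
   sets by m = 0 for minus infinity and m = n + 1 for n, and drop from M_m the condition that the
   largest cardinality is exactly 0.  The resulting set, level m, is closed under components of
   sums and exponents.  Its terms of smaller largest cardinality form an initial segment whose
   SC-terms, after applying *, lie in the earlier Acc_i.  There they are split into finitely many
   pieces, each of which is well-founded, and a finite union of such pieces is well-founded
   because < is transitive.  So this initial segment is accessible, and Acc_m is the accessible
   part of level m restricted to the terms of largest cardinality 0 (all terms if m = 0).

   The accessible part of level m is closed under sums and powers.  It contains theta alpha as
   soon as alpha is accessible in level (m + 1) and the critical subterms of alpha are accessible
   in level m, by induction on alpha.  A final induction on the size of terms, for all m
   simultaneously, shows that M_m = Acc_m. *)

theory Submission
  imports Defs
begin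

section \<open>Formal cardinalities, shifts and critical subterms\<close>

lemma finite_FC: "finite (FC J \<alpha>)"
  by (induction J \<alpha> rule: FC.induct) auto

lemma FC_nonpos: "x \<in> FC J \<alpha> \<Longrightarrow> x \<le> 0"
  by (induction J \<alpha> rule: FC.induct) (auto split: if_splits)

text \<open>Entries are indices minus the level: lowering the level by \<open>d\<close> adds
  \<open>d\<close> to each, and those that become positive belong to indices now above the
  level.\<close>

lemma FC_lower_level:
  assumes "d \<ge> 0"
  shows "FC (I - d) \<alpha> = {x + d |x. x \<in> FC I \<alpha> \<and> x + d \<le> 0}"
proof (induction \<alpha> arbitrary: I)
  case (Sum A)
  then show ?case by (auto; blast)
next
  case (Theta \<alpha>)
  have "I - d - 1 = I - 1 - d" by simp
  then show ?case by (simp only: FC.simps Theta.IH)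
qed (use assms in auto)

lemma FC_sup_less_Some:
  "FC_sup J \<alpha> < Some K \<longleftrightarrow> (\<forall>x\<in>FC J \<alpha>. x < K)"
  by (simp add: FC_sup_def finite_FC)

text \<open>No symbol moved by \<open>shift J k\<close> crosses the cut-off \<open>J\<close>, as in
  a capture-free de Bruijn shift; so the shift can be undone.\<close>

definition shiftable :: "int \<Rightarrow> int \<Rightarrow> oterm \<Rightarrow> bool" where
  "shiftable J k \<alpha> \<longleftrightarrow> (\<forall>x\<in>FC J \<alpha>. x + k \<le> 0)"

lemma shiftable_iff:
  assumes "J \<le> I"
  shows "shiftable J k \<alpha> \<longleftrightarrow> (\<forall>x\<in>FC I \<alpha>. x \<le> J - I \<longrightarrow> x + k \<le> J - I)"
  using FC_lower_level[of "I - J" I \<alpha>] assms by (fastforce simp: shiftable_def)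

lemma shiftable_simps [simp]:
  "shiftable J k (Sum A) \<longleftrightarrow> (\<forall>\<alpha>\<in>#A. shiftable J k \<alpha>)"
  "shiftable J k (Exp \<alpha>) \<longleftrightarrow> shiftable J k \<alpha>"
  "shiftable J k (Omega J') \<longleftrightarrow> (J' \<le> J \<longrightarrow> J' + k \<le> J)"
  "shiftable J k (Theta \<alpha>) \<longleftrightarrow> shiftable (J - 1) k \<alpha>"
  by (auto simp: shiftable_def)

lemma FC_shift:
  assumes "J \<le> I" "shiftable J k \<alpha>"
  shows "FC I (shift J k \<alpha>) = (\<lambda>x. if x \<le> J - I then x + k else x) ` FC I \<alpha>"
  using assms
proof (induction \<alpha> arbitrary: I J)
  case (Sum A)
  then have "FC I (shift J k (Sum A)) =
      (\<Union>\<alpha>\<in>set_mset A. (\<lambda>x. if x \<le> J - I then x + k else x) ` FC I \<alpha>)"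
    by (simp del: if_image_distrib)
  then show ?case by (simp add: image_UN del: if_image_distrib)
next
  case (Theta \<alpha>)
  then show ?case by (simp add: Theta.IH[of "J - 1" "I - 1"])
qed auto

lemma FC_shift_same:
  assumes "shiftable J k \<alpha>"
  shows "FC J (shift J k \<alpha>) = (\<lambda>x. x + k) ` FC J \<alpha>"
  using assms by (auto simp: FC_shift image_iff dest: FC_nonpos)

lemma shift_0 [simp]: "shift J 0 \<alpha> = \<alpha>"
proof (induction \<alpha> arbitrary: J)
  case (Sum A)
  then show ?case by (simp add: image_mset_cong[where g = "\<lambda>x. x"])
qed auto

text \<open>The last assumption says that no symbol lies above the cut-off \<open>P\<close> but
  within \<open>Q\<close>. So both shifts move the same symbols and the amounts add up.\<close>

lemma shift_shift:
  assumes "P \<le> Q" "shiftable P k \<alpha>" "\<And>x. x \<in> FC Q \<alpha> \<Longrightarrow> x \<le> P - Q"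
  shows "shift Q p (shift P k \<alpha>) = shift Q (k + p) \<alpha>"
  using assms
proof (induction \<alpha> arbitrary: P Q)
  case (Sum A)
  have "shift Q p (shift P k \<alpha>) = shift Q (k + p) \<alpha>" if "\<alpha> \<in># A" for \<alpha>
    using Sum.prems that by (intro Sum.IH) auto
  then show ?case by (auto simp: multiset.map_comp intro!: image_mset_cong)
next
  case (Omega J)
  show ?case using Omega(1,2) Omega(3)[of "J - Q"] by auto
next
  case (Theta \<alpha>)
  show ?case using Theta.prems by (auto intro!: Theta.IH)
qed auto

lemma shift_shift_same:
  assumes "shiftable J k \<alpha>"
  shows "shift J p (shift J k \<alpha>) = shift J (k + p) \<alpha>"
  using assms by (auto intro!: shift_shift dest: FC_nonpos)

lemma shift_inj:
  assumes "shiftable J k \<alpha>" "shiftable J k \<beta>" "shift J k \<alpha> = shift J k \<beta>"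
  shows "\<alpha> = \<beta>"
proof -
  have "shift J (- k) (shift J k \<alpha>) = \<alpha>" "shift J (- k) (shift J k \<beta>) = \<beta>"
    using assms(1,2) by (simp_all add: shift_shift_same)
  then show ?thesis using assms(3) by metis
qed

text \<open>Moving everything up to \<open>P\<close> by \<open>p\<close> carries the cut-off
  \<open>J\<close> to \<open>J + p\<close>. The bound \<open>J + p \<le> P\<close> keeps the unmoved
  symbols above \<open>P\<close> outside the new cut-off.\<close>

lemma shift_commute:
  assumes "J \<le> P" "J + p \<le> P" "shiftable J k \<alpha>"
  shows "shift P p (shift J k \<alpha>) = shift (J + p) k (shift P p \<alpha>)"
  using assms
proof (induction \<alpha> arbitrary: P J)
  case (Sum A)
  then show ?case by (auto simp: multiset.map_comp intro!: image_mset_cong)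
next
  case (Theta \<alpha>)
  have *: "J + p - 1 = J - 1 + p" by simp
  show ?case using Theta.prems by (simp add: * Theta.IH)
qed auto

section \<open>Membership in \<open>OT\<close> and \<open>HH\<close>, and its invariance under
  shifts\<close>

lemma OT_Sum_iff: "Sum A \<in> OT \<longleftrightarrow> (\<forall>\<alpha>\<in>#A. \<alpha> \<in> HH) \<and> size A \<noteq> 1"
  and Sum_notin_HH [simp]: "Sum A \<notin> HH"
  and Exp_HH_iff [simp]: "Exp \<alpha> \<in> HH \<longleftrightarrow> \<alpha> \<in> OT"
  and Exp_OT_iff [simp]: "Exp \<alpha> \<in> OT \<longleftrightarrow> \<alpha> \<in> OT"
  and Omega_HH_iff [simp]: "Omega J \<in> HH \<longleftrightarrow> J \<le> 0"
  and Omega_OT_iff [simp]: "Omega J \<in> OT \<longleftrightarrow> J \<le> 0"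
  and Theta_HH_iff [simp]: "Theta \<alpha> \<in> HH \<longleftrightarrow> \<alpha> \<in> OT"
  and Theta_OT_iff [simp]: "Theta \<alpha> \<in> OT \<longleftrightarrow> \<alpha> \<in> OT"
  by (auto intro: OT_HH.intros elim: OT.cases HH.cases)

lemma HH_in_OT: "\<alpha> \<in> HH \<Longrightarrow> \<alpha> \<in> OT"
  by (rule OT_HH.intros)

lemma in_HH_iff: "\<alpha> \<in> HH \<longleftrightarrow> \<alpha> \<in> OT \<and> (\<forall>A. \<alpha> \<noteq> Sum A)"
  by (cases \<alpha>) auto

lemma shift_eq_Sum_iff: "(\<exists>A. shift J k \<alpha> = Sum A) \<longleftrightarrow> (\<exists>A. \<alpha> = Sum A)"
  by (cases \<alpha>) auto

lemma shift_OT: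
  assumes "\<alpha> \<in> OT" "J \<le> 0" "shiftable J k \<alpha>"
  shows "shift J k \<alpha> \<in> OT"
  using assms
proof (induction \<alpha> arbitrary: J rule: oterm.induct)
  case (Sum A)
  then show ?case
    using shift_eq_Sum_iff[of J k] by (auto simp: OT_Sum_iff in_HH_iff) metis
qed auto

text \<open>Critical subterms below \<open>I\<close> are renormalized by adding
  \<open>1 - I\<close>, which turns the cut-off \<open>J\<close> into \<open>J - I + 1\<close>.
  Since \<open>J < I\<close>, shifted symbols stay below \<open>I\<close>, so the same
  theta-subterms are collected.\<close>

lemma KK_shift:
  assumes "J < I" "I \<le> 0" "shiftable J k \<alpha>"
  shows "KK I (shift J k \<alpha>) = shift (J - I + 1) k ` KK I \<alpha>"
  using assms
proof (induction \<alpha> arbitrary: I J)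
  case (Sum A)
  then show ?case by (simp add: image_UN)
next
  case (Theta \<alpha>)
  let ?t = "Theta \<alpha>"
  have "FC_sup 0 (shift J k ?t) < Some I \<longleftrightarrow> FC_sup 0 ?t < Some I"
    using Theta.prems FC_shift[of J 0 k ?t] shiftable_iff[of J 0 k ?t]
    unfolding FC_sup_less_Some
    by (fastforce simp del: FC.simps shift.simps shiftable_simps)
  moreover have "shift 0 (1 - I) (shift J k ?t) = shift (J - I + 1) k (shift 0 (1 - I) ?t)"
    using shift_commute[of J 0 "1 - I" k ?t] Theta.prems by (simp add: algebra_simps)
  moreover have "KK (I - 1) (shift (J - 1) k \<alpha>) = shift (J - I + 1) k ` KK (I - 1) \<alpha>"
    using Theta.IH[of "J - 1" "I - 1"] Theta.prems by (simp add: algebra_simps)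
  ultimately show ?case by simp
qed auto

text \<open>Critical subterms are normalized relative to the threshold, so moving term and threshold
  by the same amount changes nothing. The two bounds ensure that symbols left in place are below
  neither threshold.\<close>

lemma KK_shift_level:
  assumes "I \<le> P + 1" "I + k \<le> P + 1" "P \<le> 0" "shiftable P k \<alpha>"
  shows "KK (I + k) (shift P k \<alpha>) = KK I \<alpha>"
  using assms
proof (induction \<alpha> arbitrary: I P)
  case (Theta \<alpha>)
  let ?t = "Theta \<alpha>"
  have 1: "FC_sup 0 (shift P k ?t) < Some (I + k) \<longleftrightarrow> FC_sup 0 ?t < Some I"
    using Theta.prems FC_shift[of P 0 k ?t]
    unfolding FC_sup_less_Some
    by (auto simp del: FC.simps shift.simps shiftable_simps if_image_distrib split: if_splits)
  have 2: "shift 0 (1 - (I + k)) (shift P k ?t) = shift 0 (1 - I) ?t" if "FC_sup 0 ?t < Some I"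
    using shift_shift[of P 0 k ?t "1 - (I + k)"] Theta.prems that
    by (fastforce simp: FC_sup_less_Some simp del: FC.simps shift.simps)
  have 3: "KK (I + k - 1) (shift (P - 1) k \<alpha>) = KK (I - 1) \<alpha>"
    using Theta.IH[of "I - 1" "P - 1"] Theta.prems by (simp add: algebra_simps)
  show ?case using 1 2 3 by simp
qed auto

text \<open>The critical subterms retain exactly the cardinalities below \<open>J\<close>, with
  \<open>J - 1\<close> renormalized to 0. For \<open>J = 0\<close> this computes the cardinalities
  of a theta-term from the critical subterms of its argument.\<close>

lemma FC_KK:
  assumes "J \<le> 0"
  shows "FC (J - 1) \<alpha> = (\<Union>\<beta>\<in>KK J \<alpha>. FC 0 \<beta>)"
  using assms
proof (induction \<alpha> arbitrary: J)
  case (Theta \<alpha>)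
  let ?t = "Theta \<alpha>"
  show ?case
  proof (cases "FC_sup 0 ?t < Some J")
    case True
    then have *: "x < J" if "x \<in> FC 0 ?t" for x
      using that by (auto simp: FC_sup_less_Some simp del: FC.simps)
    have s: "shiftable 0 (1 - J) ?t"
      using * by (fastforce simp: shiftable_def simp del: shiftable_simps)
    \<comment> \<open>All cardinalities are below \<open>J\<close>, so none is discarded when the
      level drops.\<close>
    have "FC (J - 1) ?t = (\<lambda>x. x + (1 - J)) ` FC 0 ?t"
      using FC_lower_level[of "1 - J" 0 ?t] Theta.prems *
      by (fastforce simp del: FC.simps)
    then show ?thesis using True FC_shift_same[OF s] by (simp del: FC.simps shift.simps)
  next
    case False
    then show ?thesis using Theta.IH[of "J - 1"] Theta.prems by simp
  qed
qed auto

lemma FC_KK_subset: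
  assumes "J \<le> 0" "\<beta> \<in> KK 0 \<alpha>"
  shows "FC J \<beta> \<subseteq> FC (J - 1) \<alpha>"
proof -
  have "FC 0 \<beta> \<subseteq> FC (- 1) \<alpha>" using FC_KK[of 0 \<alpha>] assms(2) by auto
  then show ?thesis
    using FC_lower_level[of "- J" 0 \<beta>] FC_lower_level[of "- J" "- 1" \<alpha>] assms(1)
    by (auto simp: algebra_simps)
qed

lemma shiftable_KK:
  assumes "J \<le> 0" "\<beta> \<in> KK 0 \<alpha>" "shiftable (J - 1) k \<alpha>"
  shows "shiftable J k \<beta>"
  using FC_KK_subset[OF assms(1,2)] assms(3) by (auto simp: shiftable_def)

definition SC :: "oterm set" where
  "SC = {\<alpha> \<in> HH. \<forall>\<beta>. \<alpha> \<noteq> Exp \<beta>}"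

lemma SC_simps [simp]:
  "Sum A \<notin> SC" "Exp \<alpha> \<notin> SC" "Omega J \<in> SC \<longleftrightarrow> J \<le> 0" "Theta \<alpha> \<in> SC \<longleftrightarrow> \<alpha> \<in> OT"
  by (auto simp: SC_def)

lemma KK_SC:
  assumes "J \<le> 0" "\<alpha> \<in> OT" "\<beta> \<in> KK J \<alpha>"
  shows "\<beta> \<in> SC"
  using assms
proof (induction \<alpha> arbitrary: J)
  case (Sum A)
  then show ?case by (auto simp: OT_Sum_iff HH_in_OT)
next
  case (Omega J')
  then show ?case by (auto split: if_splits)
next
  case (Theta \<alpha>)
  show ?case
  proof (cases "FC_sup 0 (Theta \<alpha>) < Some J")
    case True
    then have "shiftable 0 (1 - J) (Theta \<alpha>)"
      by (fastforce simp: FC_sup_less_Some shiftable_def simp del: shiftable_simps)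
    then have "shift 0 (1 - J) (Theta \<alpha>) \<in> OT"
      using Theta.prems(2) by (intro shift_OT) auto
    then show ?thesis using True Theta.prems by simp
  next
    case False
    then show ?thesis using Theta.IH[of "J - 1"] Theta.prems by simp
  qed
qed auto

lemma KK_OT: "\<alpha> \<in> OT \<Longrightarrow> \<beta> \<in> KK 0 \<alpha> \<Longrightarrow> \<beta> \<in> OT"
  using KK_SC[of 0] by (auto simp: SC_def HH_in_OT)

text \<open>A theta-term collected below \<open>J\<close> carries a shift by \<open>1 - J\<close>;
  \<open>KK_shift_level\<close> trades this shift for the threshold \<open>J - 1\<close>.\<close>

lemma KK_KK:
  assumes "J \<le> 0" "\<beta> \<in> KK J \<alpha>"
  shows "KK 0 \<beta> \<subseteq> KK (J - 1) \<alpha>"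
  using assms
proof (induction \<alpha> arbitrary: J)
  case (Sum A)
  then show ?case by fastforce
next
  case (Theta \<alpha>)
  show ?case
  proof (cases "FC_sup 0 (Theta \<alpha>) < Some J")
    case True
    then have "shiftable 0 (1 - J) (Theta \<alpha>)"
      by (fastforce simp: FC_sup_less_Some shiftable_def simp del: shiftable_simps)
    then have "KK 0 (shift 0 (1 - J) (Theta \<alpha>)) = KK (J - 1) (Theta \<alpha>)"
      using KK_shift_level[of "J - 1" 0 "1 - J" "Theta \<alpha>"] Theta.prems(1)
      by (simp del: KK.simps shift.simps)
    then show ?thesis using True Theta.prems(2) by (simp del: shift.simps)
  next
    case False
    \<comment> \<open>Too large to be collected below \<open>J\<close> means too large below
      \<open>J - 1\<close>, so both operators descend into the argument.\<close>
    then have "\<not> FC_sup 0 (Theta \<alpha>) < Some (J - 1)"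
      by (force simp: FC_sup_less_Some simp del: FC.simps)
    then show ?thesis using False Theta.IH[of "J - 1"] Theta.prems by (simp add: algebra_simps)
  qed
qed (auto split: if_splits)

text \<open>Only an Omega or a theta-term collected as a whole keeps its full size, and cardinality
  0 excludes this. The final induction on size rests on this strictness.\<close>

lemma size_KK_less:
  assumes "\<beta> \<in> KK 0 \<alpha>" "0 \<in> FC 0 \<alpha>"
  shows "size \<beta> < size \<alpha>"
proof (cases \<alpha>)
  case (Sum A)
  then show ?thesis using assms(1) size_KK size_in_Sum by fastforce
next
  case (Theta \<gamma>)
  then have "\<not> FC_sup 0 (Theta \<gamma>) < Some 0"
    using assms(2) by (auto simp: FC_sup_less_Some simp del: FC.simps)
  then show ?thesis using assms(1) Theta size_KK[of \<beta> "- 1" \<gamma>] by simp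
qed (use assms size_KK in \<open>auto simp: less_Suc_eq_le split: if_splits\<close>)

section \<open>Shifts preserve the ordering\<close>

lemma less_Sum_right: "\<beta> \<in> HH \<Longrightarrow> \<beta> \<prec> Sum A \<longleftrightarrow> (\<exists>\<alpha>\<in>#A. \<beta> = \<alpha> \<or> \<beta> \<prec> \<alpha>)"
  and less_Sum_left: "\<beta> \<in> HH \<Longrightarrow> Sum A \<prec> \<beta> \<longleftrightarrow> (\<forall>\<alpha>\<in>#A. \<alpha> \<prec> \<beta>)"
  by (cases \<beta>; simp)+

lemma less_Exp_right: "\<beta> \<in> SC \<Longrightarrow> \<beta> \<prec> Exp \<alpha> \<longleftrightarrow> \<beta> = \<alpha> \<or> \<beta> \<prec> \<alpha>"
  and less_Exp_left: "\<beta> \<in> SC \<Longrightarrow> Exp \<alpha> \<prec> \<beta> \<longleftrightarrow> \<alpha> \<prec> \<beta>"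
  by (cases \<beta>; simp)+

text \<open>A theta lowers the cut-off to \<open>J - 1\<close>; passing to critical subterms of its
  argument restores \<open>J\<close>.\<close>

lemma KK_0_shift:
  assumes "J \<le> 0" "shiftable (J - 1) k \<alpha>"
  shows "KK 0 (shift (J - 1) k \<alpha>) = shift J k ` KK 0 \<alpha>"
  using KK_shift[of "J - 1" 0 k \<alpha>] assms by simp

text \<open>Sums are compared through multiset differences, so a shift must commute with
  these.\<close>

lemma image_mset_diff_inj:
  assumes "inj_on f (set_mset A \<union> set_mset B)"
  shows "image_mset f A - image_mset f B = image_mset f (A - B)"
proof (rule multiset_eqI)
  fix y
  show "count (image_mset f A - image_mset f B) y = count (image_mset f (A - B)) y"
  proof (cases "y \<in> f ` (set_mset A \<union> set_mset B)")
    case True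
    then obtain x where x: "x \<in> set_mset A \<union> set_mset B" "y = f x" by blast
    have *: "count (image_mset f M) y = count M x" if "set_mset M \<subseteq> set_mset A \<union> set_mset B" for M
    proof -
      have "f -` {y} \<inter> set_mset M = (if x \<in># M then {x} else {})"
        using assms x that by (auto simp: inj_on_def)
      then show ?thesis by (auto simp: count_image_mset not_in_iff)
    qed
    have "set_mset (A - B) \<subseteq> set_mset A \<union> set_mset B" by (meson in_diffD subsetI UnI1)
    then show ?thesis using *[of A] *[of B] *[of "A - B"] by auto
  next
    case False
    then have "y \<notin># image_mset f A" "y \<notin># image_mset f (A - B)" by (auto dest: in_diffD)
    then have "count (image_mset f A) y = 0" "count (image_mset f (A - B)) y = 0"
      unfolding not_in_iff .
    then show ?thesis by simp
  qed
qed

lemma OT_cases_pair: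
  assumes "\<alpha> \<in> OT" "\<beta> \<in> OT"
  obtains (Sum_Sum) A B where "\<alpha> = Sum A" "\<beta> = Sum B"
  | (HH_Sum) B where "\<alpha> \<in> HH" "\<beta> = Sum B"
  | (Sum_HH) A where "\<alpha> = Sum A" "\<beta> \<in> HH"
  | (Exp_Exp) a b where "\<alpha> = Exp a" "\<beta> = Exp b"
  | (SC_Exp) b where "\<alpha> \<in> SC" "\<beta> = Exp b"
  | (Exp_SC) a where "\<alpha> = Exp a" "\<beta> \<in> SC"
  | (Omega_Omega) I J where "\<alpha> = Omega I" "\<beta> = Omega J"
  | (Omega_Theta) I b where "\<alpha> = Omega I" "\<beta> = Theta b"
  | (Theta_Omega) a J where "\<alpha> = Theta a" "\<beta> = Omega J"
  | (Theta_Theta) a b where "\<alpha> = Theta a" "\<beta> = Theta b"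
  using assms by (cases \<alpha> rule: oterm.exhaust; cases \<beta> rule: oterm.exhaust; simp)

lemma OT_SumD: "Sum A \<in> OT \<Longrightarrow> \<alpha> \<in># A \<Longrightarrow> \<alpha> \<in> HH"
  by (auto simp: OT_Sum_iff)

lemma SC_in_HH: "\<alpha> \<in> SC \<Longrightarrow> \<alpha> \<in> HH"
  by (simp add: SC_def)

lemma shift_HH:
  assumes "\<alpha> \<in> HH" "J \<le> 0" "shiftable J k \<alpha>"
  shows "shift J k \<alpha> \<in> HH"
  using assms shift_OT[of \<alpha> J k] shift_eq_Sum_iff[of J k \<alpha>] by (auto simp: in_HH_iff)

lemma shift_SC:
  assumes "\<alpha> \<in> SC" "J \<le> 0" "shiftable J k \<alpha>"
  shows "shift J k \<alpha> \<in> SC"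
  using shift_HH[of \<alpha> J k] assms by (cases \<alpha>) auto

text \<open>No clause of the ordering negates a recursive comparison, so preservation alone suffices
  as induction hypothesis; injectivity enters only for multiset differences. In the theta clauses
  the arguments are shifted at cut-off \<open>J - 1\<close>, their critical subterms at
  \<open>J\<close>.\<close>

lemma shift_less:
  assumes "\<alpha> \<in> OT" "\<beta> \<in> OT" "J \<le> 0" "shiftable J k \<alpha>" "shiftable J k \<beta>" "\<alpha> \<prec> \<beta>"
  shows "shift J k \<alpha> \<prec> shift J k \<beta>"
  using assms
proof (induction "size \<alpha> + size \<beta>" arbitrary: \<alpha> \<beta> J rule: less_induct)
  case less
  note IH = less.hyps and prems = less.prems(3-6)
  have sub: "size x < size (Sum A)" "x \<in> OT" if "x \<in># A" "Sum A \<in> OT" for x A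
    using that size_in_Sum[of x A] OT_SumD[of A x] HH_in_OT by auto
  have subK: "size c < size (Theta \<gamma>)" "c \<in> OT" "shiftable J k c"
    if "c \<in> KK 0 \<gamma>" "\<gamma> \<in> OT" "shiftable J k (Theta \<gamma>)" for c \<gamma>
    using that size_KK[of c 0 \<gamma>] KK_OT[of \<gamma> c] shiftable_KK[of J c \<gamma> k] prems(1) by auto
  from less.prems(1,2) show ?case
  proof (cases rule: OT_cases_pair)
    case (Sum_Sum A B)
    from prems(4) Sum_Sum obtain b where b: "b \<in># B - A" "\<forall>a\<in>#A - B. a \<prec> b" by auto
    have inj: "inj_on (shift J k) (set_mset A \<union> set_mset B)"
      using prems Sum_Sum shift_inj[of J k] by (auto intro!: inj_onI)
    have "shift J k a \<prec> shift J k b" if a: "a \<in># A - B" for a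
    proof (rule IH)
      show "size a + size b < size \<alpha> + size \<beta>" "a \<in> OT" "b \<in> OT"
        using sub[of a A] sub[of b B] in_diffD[OF a] in_diffD[OF b(1)] less.prems Sum_Sum by auto
    qed (use prems a b Sum_Sum in \<open>auto dest: in_diffD\<close>)
    moreover have "image_mset (shift J k) B - image_mset (shift J k) A = image_mset (shift J k) (B - A)"
      "image_mset (shift J k) A - image_mset (shift J k) B = image_mset (shift J k) (A - B)"
      using inj by (auto intro!: image_mset_diff_inj simp: Un_commute)
    ultimately show ?thesis using b(1) Sum_Sum by auto
  next
    case (HH_Sum B)
    then obtain b where b: "b \<in># B" "\<alpha> = b \<or> \<alpha> \<prec> b" using prems(4) by (auto simp: less_Sum_right)
    then have "shift J k \<alpha> = shift J k b \<or> shift J k \<alpha> \<prec> shift J k b"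
      using IH[of \<alpha> b J] sub[of b B] prems less.prems HH_Sum by auto
    then show ?thesis using b HH_Sum prems by (auto simp: less_Sum_right shift_HH)
  next
    case (Sum_HH A)
    then have "shift J k a \<prec> shift J k \<beta>" if "a \<in># A" for a
      using IH[of a \<beta> J] sub[of a A] prems less.prems that by (auto simp: less_Sum_left)
    then show ?thesis using Sum_HH prems by (auto simp: less_Sum_left shift_HH)
  next
    case (Exp_Exp a b)
    then show ?thesis using IH[of a b J] prems less.prems by simp
  next
    case (SC_Exp b)
    then have "shift J k \<alpha> = shift J k b \<or> shift J k \<alpha> \<prec> shift J k b"
      using IH[of \<alpha> b J] prems less.prems by (auto simp: less_Exp_right)
    then show ?thesis using SC_Exp prems by (auto simp: less_Exp_right shift_SC)
  next
    case (Exp_SC a)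
    then have "shift J k a \<prec> shift J k \<beta>"
      using IH[of a \<beta> J] prems less.prems by (auto simp: less_Exp_left)
    then show ?thesis using Exp_SC prems by (auto simp: less_Exp_left shift_SC)
  next
    case (Omega_Omega I I')
    then show ?thesis using prems by auto
  next
    case (Omega_Theta I \<gamma>)
    then obtain b where b: "b \<in> KK 0 \<gamma>" "\<alpha> = b \<or> \<alpha> \<prec> b" using prems(4) by auto
    then have "shift J k \<alpha> = shift J k b \<or> shift J k \<alpha> \<prec> shift J k b"
      using IH[of \<alpha> b J] subK[of b \<gamma>] prems less.prems Omega_Theta by auto
    then show ?thesis using b(1) prems(1,3) Omega_Theta by (auto simp: KK_0_shift split: if_splits)
  next
    case (Theta_Omega \<gamma> I)
    then have "shift J k b \<prec> shift J k \<beta>" if "b \<in> KK 0 \<gamma>" for b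
      using IH[of b \<beta> J] subK[of b \<gamma>] prems less.prems that by auto
    then show ?thesis using prems(1,2) Theta_Omega by (auto simp: KK_0_shift split: if_splits)
  next
    case (Theta_Theta a b)
    from prems(4) Theta_Theta consider "a \<prec> b" "\<forall>c\<in>KK 0 a. c \<prec> \<beta>"
      | c where "b \<prec> a" "c \<in> KK 0 b" "\<alpha> = c \<or> \<alpha> \<prec> c" by auto
    then show ?thesis
    proof cases
      case 1
      have "shift (J - 1) k a \<prec> shift (J - 1) k b"
        using 1(1) prems less.prems Theta_Theta by (intro IH) auto
      moreover have "shift J k c \<prec> shift J k \<beta>" if "c \<in> KK 0 a" for c
        using subK[of c a] that 1(2) prems less.prems Theta_Theta by (intro IH) auto
      ultimately show ?thesis using prems(1,2) Theta_Theta by (auto simp: KK_0_shift)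
    next
      case 2
      have "shift (J - 1) k b \<prec> shift (J - 1) k a"
        using 2(1) prems less.prems Theta_Theta by (intro IH) auto
      moreover have "shift J k \<alpha> = shift J k c \<or> shift J k \<alpha> \<prec> shift J k c"
        using subK[of c b] 2(2,3) prems less.prems Theta_Theta IH[of \<alpha> c J] by auto
      ultimately show ?thesis using prems(1,3) 2(2) Theta_Theta by (auto simp: KK_0_shift)
    qed
  qed
qed

section \<open>The ordering is linear\<close>

lemma less_irrefl: "\<not> \<alpha> \<prec> \<alpha>"
  by (induction \<alpha>) auto

text \<open>Over a total order, \<open>B\<close> wins when it has the higher multiplicity at the
  largest element where the multiplicities differ. In this form comparisons compose easily.\<close>

lemma multiset_less_iff_top_difference:
  assumes "transp_on U R" "totalp_on U R" "irreflp_on U R" "set_mset A \<subseteq> U" "set_mset B \<subseteq> U"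
  shows "(\<exists>b\<in>#B - A. \<forall>a\<in>#A - B. R a b) \<longleftrightarrow>
    (\<exists>b\<in>U. count A b < count B b \<and> (\<forall>x\<in>U. R b x \<longrightarrow> count A x = count B x))"
    (is "?l \<longleftrightarrow> ?r")
proof
  assume ?l
  then obtain b where b: "b \<in># B - A" "\<forall>a\<in>#A - B. R a b" by blast
  have sub: "set_mset (B - A) \<subseteq> U" "set_mset (A - B) \<subseteq> U" using assms by (auto dest: in_diffD)
  have "\<exists>d\<in>set_mset (B - A). \<forall>x\<in>set_mset (B - A). x \<noteq> d \<longrightarrow> R x d"
    using assms sub b
    by (intro Finite_Set.bex_greatest_element)
       (auto intro: transp_on_subset totalp_on_subset)
  then obtain d where d: "d \<in># B - A" "\<And>x. x \<in># B - A \<Longrightarrow> x \<noteq> d \<Longrightarrow> R x d" by blast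
  \<comment> \<open>A counterexample \<open>x\<close> would lie in \<open>B - A\<close>, hence not
    above its maximum \<open>d\<close>, or in \<open>A - B\<close>, hence below \<open>b\<close> and
    so below \<open>d\<close>.\<close>
  have "count A x = count B x" if x: "x \<in> U" "R d x" for x
  proof (rule ccontr)
    assume "count A x \<noteq> count B x"
    then consider "x \<in># B - A" | "x \<in># A - B" by (force simp: in_diff_count)
    then have "x = d \<or> R x d"
    proof cases
      case 2
      then have "R x b" using b by blast
      then show ?thesis using d(2)[OF b(1)] b(1) d(1) x(1) sub assms(1)
        by (metis transp_onD subsetD)
    qed (use d in blast)
    then show False using x d(1) sub assms(1,3) by (metis irreflp_onD subsetD transp_onD)
  qed
  moreover have "d \<in> U" "count A d < count B d" using d(1) sub by (auto simp: in_diff_count)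
  ultimately show ?r by blast
next
  assume ?r
  then obtain b where b: "b \<in> U" "count A b < count B b"
    "\<And>x. x \<in> U \<Longrightarrow> R b x \<Longrightarrow> count A x = count B x" by blast
  have "R a b" if "a \<in># A - B" for a
  proof -
    have "count B a < count A a" "a \<in> U" using that assms(4) in_diffD[OF that] by (auto simp: in_diff_count)
    then have "a \<noteq> b" "\<not> R b a" using b(2) b(3)[of a] by auto
    then show ?thesis using totalp_onD[OF assms(2) \<open>a \<in> U\<close> b(1)] by blast
  qed
  moreover have "b \<in># B - A" using b(2) by (simp add: in_diff_count)
  ultimately show ?l by blast
qed

text \<open>Each comparison has a deciding element; the larger of the two decides the composed
  comparison.\<close>

lemma multiset_less_trans:
  assumes "transp_on U R" "totalp_on U R" "irreflp_on U R"
    "set_mset A \<subseteq> U" "set_mset B \<subseteq> U" "set_mset C \<subseteq> U"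
    "\<exists>b\<in>#B - A. \<forall>a\<in>#A - B. R a b" "\<exists>c\<in>#C - B. \<forall>b\<in>#B - C. R b c"
  shows "\<exists>c\<in>#C - A. \<forall>a\<in>#A - C. R a c"
proof -
  obtain b where b: "b \<in> U" "count A b < count B b" "\<And>x. x \<in> U \<Longrightarrow> R b x \<Longrightarrow> count A x = count B x"
    using assms multiset_less_iff_top_difference[of U R A B] by blast
  obtain c where c: "c \<in> U" "count B c < count C c" "\<And>x. x \<in> U \<Longrightarrow> R c x \<Longrightarrow> count B x = count C x"
    using assms multiset_less_iff_top_difference[of U R B C] by blast
  have "\<exists>d\<in>U. count A d < count C d \<and> (\<forall>x\<in>U. R d x \<longrightarrow> count A x = count C x)"
  proof -
    consider "b = c" | "R b c" | "R c b" using assms(2) b(1) c(1) by (metis totalp_onD)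
    then show ?thesis
    proof cases
      case 1
      then have "count A b < count C b" using b(2) c(2) by simp
      moreover have "count A x = count C x" if "x \<in> U" "R b x" for x
        using that b(3)[of x] c(3)[of x] 1 by simp
      ultimately show ?thesis using b(1) by blast
    next
      case 2
      then have "R b x" if "x \<in> U" "R c x" for x
        using that assms(1) b(1) c(1) by (metis transp_onD)
      then have "count A c < count C c" using b(3)[of c] c(1,2) 2 by simp
      moreover have "count A x = count C x" if "x \<in> U" "R c x" for x
        using that b(3)[of x] c(3)[of x] \<open>\<And>x. x \<in> U \<Longrightarrow> R c x \<Longrightarrow> R b x\<close> by simp
      ultimately show ?thesis using c(1) by blast
    next
      case 3
      then have "R c x" if "x \<in> U" "R b x" for x
        using that assms(1) b(1) c(1) by (metis transp_onD)
      then have "count A b < count C b" using c(3)[of b] b(1,2) 3 by simp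
      moreover have "count A x = count C x" if "x \<in> U" "R b x" for x
        using that b(3)[of x] c(3)[of x] \<open>\<And>x. x \<in> U \<Longrightarrow> R b x \<Longrightarrow> R c x\<close> by simp
      ultimately show ?thesis using b(1) by blast
    qed
  qed
  then show ?thesis using assms multiset_less_iff_top_difference[of U R A C] by blast
qed

text \<open>The largest element of the symmetric difference decides.\<close>

lemma multiset_less_total:
  assumes "transp_on U R" "totalp_on U R" "irreflp_on U R" "set_mset A \<subseteq> U" "set_mset B \<subseteq> U" "A \<noteq> B"
  shows "(\<exists>b\<in>#B - A. \<forall>a\<in>#A - B. R a b) \<or> (\<exists>a\<in>#A - B. \<forall>b\<in>#B - A. R b a)"
proof -
  define D where "D = set_mset (A - B) \<union> set_mset (B - A)"
  have "set_mset (A - B) \<subseteq> U" "set_mset (B - A) \<subseteq> U" using assms(4,5) by (meson in_diffD subset_iff)+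
  then have D: "D \<subseteq> U" "finite D" by (simp_all add: D_def)
  obtain x where "count A x \<noteq> count B x" using assms(6) by (auto simp: multiset_eq_iff)
  then have "x \<in># A - B \<or> x \<in># B - A" by (auto simp: in_diff_count)
  then have "D \<noteq> {}" by (auto simp: D_def)
  then have "\<exists>d\<in>D. \<forall>x\<in>D. x \<noteq> d \<longrightarrow> R x d"
    using assms(1,2) D
    by (intro Finite_Set.bex_greatest_element) (auto intro: transp_on_subset totalp_on_subset)
  then obtain d where d: "d \<in> D" "\<And>x. x \<in> D \<Longrightarrow> x \<noteq> d \<Longrightarrow> R x d" by blast
  have disj: "x \<notin># B - A" if "x \<in># A - B" for x using that by (auto simp: in_diff_count)
  from d(1) consider "d \<in># A - B" | "d \<in># B - A" by (auto simp: D_def)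
  then show ?thesis
  proof cases
    case 1
    then have "\<forall>b\<in>#B - A. R b d" using d disj unfolding D_def by (metis UnI2)
    then show ?thesis using 1 by blast
  next
    case 2
    then have "\<forall>a\<in>#A - B. R a d" using d disj unfolding D_def by (metis UnI1)
    then show ?thesis using 2 by blast
  qed
qed

section \<open>Totality and transitivity by induction on a size bound\<close>

lemma Sum_memD:
  assumes "Sum A \<in> OT" "\<alpha> \<in># A"
  shows "size \<alpha> < size (Sum A)" "\<alpha> \<in> OT"
  using assms size_in_Sum[of \<alpha> A] OT_SumD HH_in_OT by auto

lemma KK_memD:
  assumes "Theta \<alpha> \<in> OT" "\<beta> \<in> KK 0 \<alpha>"
  shows "size \<beta> < size (Theta \<alpha>)" "\<beta> \<in> OT"
  using assms size_KK[of \<beta> 0 \<alpha>] KK_OT[of \<alpha> \<beta>] by auto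

text \<open>Picking the largest element of the symmetric difference of two sums needs transitivity for
  arbitrary triples of summands, while transitivity needs totality for terms of the same size.
  Hence totality and transitivity are proved alternately along a bound on the size of the terms.\<close>

lemma less_total_step:
  assumes tr: "transp_on {\<alpha> \<in> OT. size \<alpha> < N} (\<prec>)"
  shows "totalp_on {\<alpha> \<in> OT. size \<alpha> \<le> N} (\<prec>)"
proof -
  have "\<alpha> \<prec> \<beta> \<or> \<alpha> = \<beta> \<or> \<beta> \<prec> \<alpha>"
    if "\<alpha> \<in> OT" "\<beta> \<in> OT" "size \<alpha> \<le> N" "size \<beta> \<le> N" for \<alpha> \<beta>
    using that
  proof (induction "size \<alpha> + size \<beta>" arbitrary: \<alpha> \<beta> rule: less_induct)
    case less
    note IH = less.hyps and prems = less.prems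
    from prems(1,2) show ?case
    proof (cases rule: OT_cases_pair)
      case (Sum_Sum A B)
      define U where "U = set_mset A \<union> set_mset B"
      have mem: "x \<in> OT \<and> size x < N \<and> (x \<in># A \<and> size x < size \<alpha> \<or> x \<in># B \<and> size x < size \<beta>)"
        if "x \<in> U" for x
        using that Sum_memD[of A x] Sum_memD[of B x] prems Sum_Sum by (auto simp: U_def)
      have "x \<prec> y \<or> y \<prec> x" if "x \<in> U" "y \<in> U" "x \<noteq> y" for x y
      proof -
        have "size x + size y < size \<alpha> + size \<beta>"
        proof -
          \<comment> \<open>Both elements may be summands of one sum; being distinct, they occupy
            separate places in it, so their sizes together stay below its size.\<close>
          have *: "size x + size y < size (Sum M)" if "x \<in># M" "y \<in># M" for M
          proof -
            have "{#x, y#} \<subseteq># M" using that \<open>x \<noteq> y\<close> by (simp add: insert_subset_eq_iff in_diff_count not_in_iff)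
            then obtain M' where "M = {#x, y#} + M'" by (auto simp: mset_subset_eq_exists_conv)
            then show ?thesis by simp
          qed
          show ?thesis using mem[OF that(1)] mem[OF that(2)] *[of A] *[of B] Sum_Sum
            by (metis add_less_mono add.commute trans_less_add1 trans_less_add2)
        qed
        then show ?thesis using IH[of x y] mem that by fastforce
      qed
      then have tot: "totalp_on U (\<prec>)" by (auto simp: totalp_on_def)
      have "transp_on U (\<prec>)" using mem by (auto intro: transp_on_subset[OF tr])
      moreover have "irreflp_on U (\<prec>)" using less_irrefl by (auto simp: irreflp_on_def)
      ultimately show ?thesis
        using multiset_less_total[of U "(\<prec>)" A B] tot Sum_Sum by (auto simp: U_def)
    next
      case (HH_Sum B)
      have "\<alpha> \<prec> b \<or> \<alpha> = b \<or> b \<prec> \<alpha>" if "b \<in># B" for b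
        using that Sum_memD[of B b] HH_Sum prems by (intro IH) auto
      then show ?thesis using HH_Sum by (auto simp: less_Sum_right less_Sum_left)
    next
      case (Sum_HH A)
      have "a \<prec> \<beta> \<or> a = \<beta> \<or> \<beta> \<prec> a" if "a \<in># A" for a
        using that Sum_memD[of A a] Sum_HH prems by (intro IH) auto
      then show ?thesis using Sum_HH by (auto simp: less_Sum_right less_Sum_left)
    next
      case (Exp_Exp a b)
      then show ?thesis using IH[of a b] prems by auto
    next
      case (SC_Exp b)
      then show ?thesis using IH[of \<alpha> b] prems by (auto simp: less_Exp_right less_Exp_left)
    next
      case (Exp_SC a)
      then show ?thesis using IH[of a \<beta>] prems by (auto simp: less_Exp_right less_Exp_left)
    next
      case (Omega_Omega I J)
      then show ?thesis by auto
    next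
      case (Omega_Theta I b)
      have "\<alpha> \<prec> c \<or> \<alpha> = c \<or> c \<prec> \<alpha>" if "c \<in> KK 0 b" for c
        using that KK_memD[of b c] Omega_Theta prems by (intro IH) auto
      then show ?thesis using Omega_Theta by auto
    next
      case (Theta_Omega a J)
      have "\<beta> \<prec> c \<or> \<beta> = c \<or> c \<prec> \<beta>" if "c \<in> KK 0 a" for c
        using that KK_memD[of a c] Theta_Omega prems by (intro IH) auto
      then show ?thesis using Theta_Omega by auto
    next
      case (Theta_Theta a b)
      have "\<beta> \<prec> c \<or> \<beta> = c \<or> c \<prec> \<beta>" if "c \<in> KK 0 a" for c
        using that KK_memD[of a c] Theta_Theta prems by (intro IH) auto
      moreover have "\<alpha> \<prec> c \<or> \<alpha> = c \<or> c \<prec> \<alpha>" if "c \<in> KK 0 b" for c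
        using that KK_memD[of b c] Theta_Theta prems by (intro IH) auto
      moreover have "a \<prec> b \<or> a = b \<or> b \<prec> a"
        using Theta_Theta prems by (intro IH) auto
      ultimately show ?thesis using Theta_Theta by auto
    qed
  qed
  then show ?thesis by (auto simp: totalp_on_def)
qed

lemma less_trans_step:
  assumes tr: "transp_on {\<alpha> \<in> OT. size \<alpha> < N} (\<prec>)"
    and tot: "totalp_on {\<alpha> \<in> OT. size \<alpha> \<le> N} (\<prec>)"
  shows "transp_on {\<alpha> \<in> OT. size \<alpha> \<le> N} (\<prec>)"
proof -
  have "\<alpha> \<prec> \<gamma>"
    if "\<alpha> \<in> OT" "\<beta> \<in> OT" "\<gamma> \<in> OT" "size \<alpha> \<le> N" "size \<beta> \<le> N" "size \<gamma> \<le> N" "\<alpha> \<prec> \<beta>" "\<beta> \<prec> \<gamma>"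
    for \<alpha> \<beta> \<gamma>
    using that
  proof (induction "size \<alpha> + size \<beta> + size \<gamma>" arbitrary: \<alpha> \<beta> \<gamma> rule: less_induct)
    case less
    note prems = less.prems
    have IH: "x \<prec> z"
      if "x \<prec> y" "y \<prec> z" "size x + size y + size z < size \<alpha> + size \<beta> + size \<gamma>"
        "x \<in> OT" "y \<in> OT" "z \<in> OT" "size x \<le> N" "size y \<le> N" "size z \<le> N" for x y z
      using less.hyps[of x y z] that by blast
    consider (ab_Sum) "\<beta> \<in> HH" "\<gamma> \<in> HH" "\<alpha> \<notin> HH" | (b_Sum) "\<beta> \<notin> HH" | (c_Sum) "\<gamma> \<notin> HH" "\<beta> \<in> HH"
      | (HH) "\<alpha> \<in> HH" "\<beta> \<in> HH" "\<gamma> \<in> HH" by blast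
    then show ?case
    proof cases
      case ab_Sum
      then obtain A where A: "\<alpha> = Sum A" using prems(1) by (auto simp: in_HH_iff)
      have "a \<prec> \<gamma>" if "a \<in># A" for a
        using that Sum_memD[of A a] A prems ab_Sum by (intro IH[of a \<beta> \<gamma>]) (auto simp: less_Sum_left)
      then show ?thesis using A ab_Sum by (simp add: less_Sum_left)
    next
      case b_Sum
      then obtain B where B: "\<beta> = Sum B" using prems(2) by (auto simp: in_HH_iff)
      show ?thesis
      proof (cases "\<gamma> \<in> HH")
        case True
        then have b: "b \<prec> \<gamma>" if "b \<in># B" for b using that prems(8) B by (simp add: less_Sum_left)
        show ?thesis
        proof (cases "\<alpha> \<in> HH")
          case True
          then obtain b where "b \<in># B" "\<alpha> = b \<or> \<alpha> \<prec> b"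
            using prems(7) B by (auto simp: less_Sum_right)
          then show ?thesis
            using IH[of \<alpha> b \<gamma>] b[of b] Sum_memD[of B b] B prems by auto
        next
          case False
          then obtain A where A: "\<alpha> = Sum A" using prems(1) by (auto simp: in_HH_iff)
          have "a \<prec> \<gamma>" if a: "a \<in># A" for a
          proof (cases "a \<in># B")
            case False
            then have "a \<in># A - B" using a by (simp add: in_diff_count not_in_iff)
            then obtain b' where "b' \<in># B" "a \<prec> b'"
              using prems(7) A B by (auto dest: in_diffD)
            then show ?thesis
              using IH[of a b' \<gamma>] b[of b'] Sum_memD[of B b'] Sum_memD[of A a] a A B prems by auto
          qed (use b in auto)
          then show ?thesis using A \<open>\<gamma> \<in> HH\<close> by (simp add: less_Sum_left)
        qed
      next
        case False
        then obtain C where C: "\<gamma> = Sum C" using prems(3) by (auto simp: in_HH_iff)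
        show ?thesis
        proof (cases "\<alpha> \<in> HH")
          case True
          then obtain b where b: "b \<in># B" "\<alpha> = b \<or> \<alpha> \<prec> b"
            using prems(7) B by (auto simp: less_Sum_right)
          have "\<exists>c\<in>#C. b = c \<or> b \<prec> c"
          proof (cases "b \<in># C")
            case False
            then have "b \<in># B - C" using b by (simp add: in_diff_count not_in_iff)
            then show ?thesis using prems(8) B C by (auto dest: in_diffD)
          qed auto
          then obtain c where c: "c \<in># C" "b = c \<or> b \<prec> c" by blast
          then have "\<alpha> = c \<or> \<alpha> \<prec> c"
            using b IH[of \<alpha> b c] Sum_memD[of B b] Sum_memD[of C c] B C prems by auto
          then show ?thesis using C True c(1) by (auto simp: less_Sum_right)
        next
          case False
          then obtain A where A: "\<alpha> = Sum A" using prems(1) by (auto simp: in_HH_iff)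
          define U where "U = set_mset A \<union> set_mset B \<union> set_mset C"
          have mem: "x \<in> OT \<and> size x < N" if "x \<in> U" for x
            using that Sum_memD[of A x] Sum_memD[of B x] Sum_memD[of C x] prems A B C
            by (auto simp: U_def)
          have "transp_on U (\<prec>)" using mem by (auto intro: transp_on_subset[OF tr])
          moreover have "totalp_on U (\<prec>)"
            using mem by (auto intro!: totalp_on_subset[OF tot] dest: less_imp_le)
          moreover have "irreflp_on U (\<prec>)" using less_irrefl by (auto simp: irreflp_on_def)
          moreover have "set_mset A \<subseteq> U" "set_mset B \<subseteq> U" "set_mset C \<subseteq> U" by (auto simp: U_def)
          ultimately show ?thesis
            using multiset_less_trans[of U "(\<prec>)" A B C] prems(7,8) unfolding A B C by simp
        qed
      qed
    next
      case c_Sum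
      then obtain C where C: "\<gamma> = Sum C" using prems(3) by (auto simp: in_HH_iff)
      then obtain c where c: "c \<in># C" "\<beta> = c \<or> \<beta> \<prec> c"
        using prems(8) c_Sum by (auto simp: less_Sum_right)
      show ?thesis
      proof (cases "\<alpha> \<in> HH")
        case True
        then have "\<alpha> \<prec> c" using c IH[of \<alpha> \<beta> c] Sum_memD[of C c] C prems by auto
        then show ?thesis using C True c(1) by (auto simp: less_Sum_right)
      next
        case False
        then obtain A where A: "\<alpha> = Sum A" using prems(1) by (auto simp: in_HH_iff)
        have a: "a \<prec> c" if "a \<in># A" for a
        proof -
          have "a \<prec> \<beta>" using that A c_Sum prems(7) by (simp add: less_Sum_left)
          then show ?thesis
            using that c IH[of a \<beta> c] Sum_memD[of C c] Sum_memD[of A a] A C prems by auto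
        qed
        \<comment> \<open>All summands of \<open>A\<close> are strictly below \<open>c\<close>, so
          \<open>c\<close> survives in \<open>C - A\<close> and is the witness.\<close>
        then have "c \<notin># A" using less_irrefl by blast
        then have "c \<in># C - A" using c(1) by (simp add: in_diff_count not_in_iff)
        then show ?thesis using a A C by (auto dest: in_diffD)
      qed
    next
      case HH
      consider (e) a where "\<alpha> = Exp a" | (s) "\<alpha> \<in> SC" using HH by (auto simp: SC_def)
      \<comment> \<open>Triples containing a power: each comparison with a power reduces to one with
        its exponent.\<close>
      then have SC_or_Exp: ?thesis if non_SC: "\<beta> \<notin> SC \<or> \<gamma> \<notin> SC \<or> \<alpha> \<notin> SC"
      proof cases
        case e
        show ?thesis
        proof (cases "\<beta> \<in> SC")
          case True
          then have "a \<prec> \<beta>" using prems(7) e by (simp add: less_Exp_left)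
          show ?thesis
          proof (cases "\<gamma> \<in> SC")
            case True
            have "a \<prec> \<gamma>" using \<open>a \<prec> \<beta>\<close> e prems by (intro IH[of a \<beta> \<gamma>]) auto
            then show ?thesis using True e by (simp add: less_Exp_left)
          next
            case False
            then obtain c where c: "\<gamma> = Exp c" using HH by (auto simp: SC_def)
            then have "\<beta> = c \<or> \<beta> \<prec> c" using prems(8) \<open>\<beta> \<in> SC\<close> by (simp add: less_Exp_right)
            then show ?thesis using \<open>a \<prec> \<beta>\<close> IH[of a \<beta> c] e c prems by auto
          qed
        next
          case False
          then obtain b where b: "\<beta> = Exp b" using HH by (auto simp: SC_def)
          then have "a \<prec> b" using prems(7) e by simp
          show ?thesis
          proof (cases "\<gamma> \<in> SC")
            case True
            then have "b \<prec> \<gamma>" using prems(8) b by (simp add: less_Exp_left)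
            then have "a \<prec> \<gamma>" using \<open>a \<prec> b\<close> e b prems by (intro IH[of a b \<gamma>]) auto
            then show ?thesis using True e by (simp add: less_Exp_left)
          next
            case False
            then obtain c where c: "\<gamma> = Exp c" using HH by (auto simp: SC_def)
            then show ?thesis using \<open>a \<prec> b\<close> IH[of a b c] e b c prems by auto
          qed
        qed
      next
        case s
        show ?thesis
        proof (cases "\<beta> \<in> SC")
          case True
          then obtain c where c: "\<gamma> = Exp c" using HH s non_SC True by (auto simp: SC_def)
          then have "\<beta> = c \<or> \<beta> \<prec> c" using prems(8) True by (simp add: less_Exp_right)
          then have "\<alpha> \<prec> c" using IH[of \<alpha> \<beta> c] c prems by auto
          then show ?thesis using s c by (simp add: less_Exp_right)
        next
          case False
          then obtain b where b: "\<beta> = Exp b" using HH by (auto simp: SC_def)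
          then have ab: "\<alpha> = b \<or> \<alpha> \<prec> b" using prems(7) s by (simp add: less_Exp_right)
          show ?thesis
          proof (cases "\<gamma> \<in> SC")
            case True
            then have "b \<prec> \<gamma>" using prems(8) b by (simp add: less_Exp_left)
            then show ?thesis using ab IH[of \<alpha> b \<gamma>] b prems by auto
          next
            case False
            then obtain c where c: "\<gamma> = Exp c" using HH by (auto simp: SC_def)
            then have "\<alpha> \<prec> c" using ab IH[of \<alpha> b c] b prems by auto
            then show ?thesis using s c by (simp add: less_Exp_right)
          qed
        qed
      qed
      show ?thesis
      proof (cases "\<alpha> \<in> SC \<and> \<beta> \<in> SC \<and> \<gamma> \<in> SC")
        case False
        then show ?thesis using SC_or_Exp by blast
      next
        case True
        show ?thesis
        proof (cases \<alpha> rule: oterm.exhaust)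
          case (Omega I)
          show ?thesis
          proof (cases \<beta> rule: oterm.exhaust)
            case (Omega J)
            show ?thesis
            proof (cases \<gamma> rule: oterm.exhaust)
              case (Theta c)
              then obtain k where k: "k \<in> KK 0 c" "\<beta> = k \<or> \<beta> \<prec> k" using prems(8) Omega by auto
              then have "\<alpha> \<prec> k" using IH[of \<alpha> \<beta> k] KK_memD[of c k] Theta prems by auto
              then show ?thesis using k \<open>\<alpha> = Omega I\<close> Theta by auto
            qed (use True prems(7,8) \<open>\<alpha> = Omega I\<close> Omega in auto)
          next
            case (Theta b)
            then obtain k where k: "k \<in> KK 0 b" "\<alpha> = k \<or> \<alpha> \<prec> k" using prems(7) Omega by auto
            note kb = KK_memD[of b k]
            show ?thesis
            proof (cases \<gamma> rule: oterm.exhaust)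
              case [simp]: (Omega J)
              have "k \<prec> \<gamma>" using prems(8) Theta k(1) by auto
              then show ?thesis using k IH[of \<alpha> k \<gamma>] kb Theta prems by auto
            next
              case (Theta c)
              note c = Theta
              from prems(8) \<open>\<beta> = Theta b\<close> c consider
                "b \<prec> c" "\<forall>k\<in>KK 0 b. k \<prec> \<gamma>" | k' where "k' \<in> KK 0 c" "\<beta> = k' \<or> \<beta> \<prec> k'" by auto
              then show ?thesis
              proof cases
                case 1
                then show ?thesis using k IH[of \<alpha> k \<gamma>] kb \<open>\<beta> = Theta b\<close> prems by auto
              next
                case 2
                then have "\<alpha> \<prec> k'" using IH[of \<alpha> \<beta> k'] KK_memD[of c k'] c prems by auto
                then show ?thesis using 2(1) \<open>\<alpha> = Omega I\<close> c by auto
              qed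
            qed (use True in auto)
          qed (use True in auto)
        next
          case (Theta a)
          note a = Theta
          show ?thesis
          proof (cases \<beta> rule: oterm.exhaust)
            case (Omega J)
            note b = Omega
            have ka: "k \<prec> \<beta>" if "k \<in> KK 0 a" for k using that prems(7) a b by auto
            have kc: "k \<prec> \<gamma>" if "k \<in> KK 0 a" for k
              using that ka[of k] IH[of k \<beta> \<gamma>] KK_memD[of a k] a prems by auto
            show ?thesis
            proof (cases \<gamma> rule: oterm.exhaust)
              case (Omega J')
              then show ?thesis using kc a by auto
            next
              case (Theta c)
              note c = Theta
              then obtain k where k: "k \<in> KK 0 c" "\<beta> = k \<or> \<beta> \<prec> k" using prems(8) b by auto
              have ak: "\<alpha> \<prec> k" using k prems IH[of \<alpha> \<beta> k] KK_memD[of c k] c by auto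
              \<comment> \<open>Neither hypothesis compares the theta arguments, so totality splits
                the cases. If \<open>a \<prec> c\<close>, all critical subterms of \<open>a\<close>
                lie below \<open>\<gamma>\<close>; if \<open>c \<prec> a\<close>, the critical
                subterm \<open>k\<close> of \<open>c\<close> lies above \<open>\<alpha>\<close>. If
                \<open>a = c\<close>, then \<open>k\<close> is critical for \<open>a\<close>, hence
                below \<open>\<beta>\<close> and so below itself.\<close>
              consider "a \<prec> c" | "a = c" | "c \<prec> a"
                using totalp_onD[OF tot, of a c] prems a c by auto
              then show ?thesis
              proof cases
                case 2
                then have "k \<prec> k"
                  using k ka[of k] IH[of k \<beta> k] KK_memD[of a k] a c prems by auto
                then show ?thesis using less_irrefl by blast
              qed (use kc ak k(1) a c in auto)
            qed (use True in auto)
          next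
            case (Theta b)
            note b = Theta
            from prems(7) a b consider
              (1) "a \<prec> b" "\<forall>k\<in>KK 0 a. k \<prec> \<beta>"
              | (2) k where "b \<prec> a" "k \<in> KK 0 b" "\<alpha> = k \<or> \<alpha> \<prec> k" by auto
            then show ?thesis
            proof cases
              case 1
              have kc: "k \<prec> \<gamma>" if "k \<in> KK 0 a" for k
                using that 1(2) IH[of k \<beta> \<gamma>] KK_memD[of a k] a prems by auto
              show ?thesis
              proof (cases \<gamma> rule: oterm.exhaust)
                case (Omega J)
                then show ?thesis using kc a by auto
              next
                case (Theta c)
                note c = Theta
                from prems(8) b c consider "b \<prec> c" | k where "c \<prec> b" "k \<in> KK 0 c" "\<beta> = k \<or> \<beta> \<prec> k"
                  by auto
                then show ?thesis
                proof cases
                  case 1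
                  then have "a \<prec> c" using \<open>a \<prec> b\<close> IH[of a b c] a b c prems by auto
                  then show ?thesis using kc a c by auto
                next
                  case 2
                  have ak: "\<alpha> \<prec> k" using 2 prems IH[of \<alpha> \<beta> k] KK_memD[of c k] c by auto
                  \<comment> \<open>Both \<open>a\<close> and \<open>c\<close> are only known to lie
                    below \<open>b\<close>, so totality is needed to compare them.\<close>
                  consider "a \<prec> c" | "a = c" | "c \<prec> a"
                    using totalp_onD[OF tot, of a c] prems a c by auto
                  then show ?thesis
                  proof cases
                    case 2
                    then have "k \<prec> k"
                      using \<open>k \<in> KK 0 c\<close> \<open>\<beta> = k \<or> \<beta> \<prec> k\<close> \<open>\<forall>k\<in>KK 0 a. k \<prec> \<beta>\<close>
                        IH[of k \<beta> k] KK_memD[of a k] a c prems by auto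
                    then show ?thesis using less_irrefl by blast
                  qed (use kc ak 2(2) a c in auto)
                qed
              qed (use True in auto)
            next
              case 2
              note kb = KK_memD[of b k]
              show ?thesis
              proof (cases \<gamma> rule: oterm.exhaust)
                case (Omega J)
                have "k \<prec> \<gamma>" using prems(8) b 2(2) Omega by auto
                then show ?thesis using 2 IH[of \<alpha> k \<gamma>] kb b prems by auto
              next
                case (Theta c)
                note c = Theta
                from prems(8) b c consider "b \<prec> c" "\<forall>k\<in>KK 0 b. k \<prec> \<gamma>"
                  | k' where "c \<prec> b" "k' \<in> KK 0 c" "\<beta> = k' \<or> \<beta> \<prec> k'" by auto
                then show ?thesis
                proof cases
                  case 1
                  then show ?thesis using 2 IH[of \<alpha> k \<gamma>] kb b prems by auto
                next
                  case c2: 2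
                  have "\<alpha> \<prec> k'" using c2 prems IH[of \<alpha> \<beta> k'] KK_memD[of c k'] c by auto
                  moreover have "c \<prec> a" using IH[of c b a] c2(1) 2(1) a b c prems by auto
                  ultimately show ?thesis using c2(2) a c by auto
                qed
              qed (use True in auto)
            qed
          qed (use True in auto)
        qed (use True in auto)
      qed
    qed
  qed
  then show ?thesis by (intro transp_onI) blast
qed

lemma less_linear_upto:
  "transp_on {\<alpha> \<in> OT. size \<alpha> \<le> N} (\<prec>) \<and> totalp_on {\<alpha> \<in> OT. size \<alpha> \<le> N} (\<prec>)"
proof (induction N rule: less_induct)
  case (less N)
  have "transp_on {\<alpha> \<in> OT. size \<alpha> < N} (\<prec>)"
  proof (cases N)
    case (Suc M)
    then show ?thesis using less[of M] by (simp add: less_Suc_eq_le)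
  qed (simp add: transp_on_def)
  then show ?case using less_total_step less_trans_step by blast
qed

lemma less_trans_OT:
  assumes "\<alpha> \<in> OT" "\<beta> \<in> OT" "\<gamma> \<in> OT" "\<alpha> \<prec> \<beta>" "\<beta> \<prec> \<gamma>"
  shows "\<alpha> \<prec> \<gamma>"
  using less_linear_upto[of "max (size \<alpha>) (max (size \<beta>) (size \<gamma>))"] assms
    transp_onD[of _ "(\<prec>)" \<alpha> \<beta> \<gamma>] by force

section \<open>Accessible parts\<close>

lemma wf_part_subset: "wf_part M \<subseteq> M"
  by (auto simp: wf_part_def)

lemma wf_part_downward:
  assumes "\<alpha> \<in> wf_part M" "\<beta> \<in> M" "\<beta> \<prec> \<alpha>"
  shows "\<beta> \<in> wf_part M"
  using assms by (auto simp: wf_part_def intro: acc_downward)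

lemma wf_partI:
  assumes "\<alpha> \<in> M" "\<And>\<beta>. \<beta> \<in> M \<Longrightarrow> \<beta> \<prec> \<alpha> \<Longrightarrow> \<beta> \<in> wf_part M"
  shows "\<alpha> \<in> wf_part M"
  using assms unfolding wf_part_def by (auto intro: accI)

lemma wf_part_induct [consumes 1, case_names less]:
  assumes "\<alpha> \<in> wf_part M"
    "\<And>\<alpha>. \<alpha> \<in> wf_part M \<Longrightarrow> (\<And>\<beta>. \<beta> \<in> M \<Longrightarrow> \<beta> \<prec> \<alpha> \<Longrightarrow> P \<beta>) \<Longrightarrow> P \<alpha>"
  shows "P \<alpha>"
proof -
  let ?r = "{(\<beta>, \<gamma>). \<beta> \<in> M \<and> \<gamma> \<in> M \<and> \<beta> \<prec> \<gamma>}"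
  have "\<alpha> \<in> M \<Longrightarrow> P \<alpha>" if "\<alpha> \<in> Wellfounded.acc ?r" for \<alpha>
    using that
  proof (induction rule: acc_induct_rule)
    case (1 \<alpha>)
    then show ?case using assms(2)[of \<alpha>] by (auto simp: wf_part_def intro: accI)
  qed
  then show ?thesis using assms(1) by (auto simp: wf_part_def)
qed

lemma wfp_on_wf_part: "wfp_on (wf_part M) (\<prec>)"
  unfolding wfp_on_def
proof (intro allI impI ballI)
  fix P \<alpha>
  assume *: "\<forall>\<alpha>\<in>wf_part M. (\<forall>\<beta>\<in>wf_part M. \<beta> \<prec> \<alpha> \<longrightarrow> P \<beta>) \<longrightarrow> P \<alpha>" and "\<alpha> \<in> wf_part M"
  from this(2) show "P \<alpha>"
    by (induction rule: wf_part_induct) (use * wf_part_subset in blast)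
qed

section \<open>Reducing accessibility to SC-terms\<close>

lemma OT_cases:
  assumes "\<alpha> \<in> OT"
  obtains (Sum) A where "\<alpha> = Sum A" "\<And>\<beta>. \<beta> \<in># A \<Longrightarrow> \<beta> \<in> HH"
  | (Exp) \<beta> where "\<alpha> = Exp \<beta>" "\<beta> \<in> OT"
  | (SC) "\<alpha> \<in> SC"
  using assms by (cases \<alpha> rule: oterm.exhaust) (auto simp: OT_Sum_iff)

text \<open>The closure properties under which accessibility in \<open>Y\<close> reduces to its
  SC-terms. Arguments of theta are left out because they will belong to the next level.\<close>

definition hereditary :: "oterm set \<Rightarrow> bool" where
  "hereditary Y \<longleftrightarrow> Y \<subseteq> OT \<and> (\<forall>A. Sum A \<in> Y \<longrightarrow> set_mset A \<subseteq> Y) \<and> (\<forall>\<alpha>. Exp \<alpha> \<in> Y \<longrightarrow> \<alpha> \<in> Y)"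

lemma hereditaryD:
  assumes "hereditary Y"
  shows "\<alpha> \<in> Y \<Longrightarrow> \<alpha> \<in> OT" "Sum A \<in> Y \<Longrightarrow> \<alpha> \<in># A \<Longrightarrow> \<alpha> \<in> Y" "Exp \<alpha> \<in> Y \<Longrightarrow> \<alpha> \<in> Y"
  using assms by (auto simp: hereditary_def)

text \<open>Sums of accessible terms are compared as multisets over a well-founded relation, so the
  induction runs along its multiset extension.\<close>

lemma Sum_in_wf_part:
  assumes Y: "hereditary Y" and "Sum A \<in> Y" "set_mset A \<subseteq> wf_part Y"
  shows "Sum A \<in> wf_part Y"
proof -
  define r where "r = {(\<beta>, \<gamma>). \<beta> \<in> wf_part Y \<and> \<gamma> \<in> wf_part Y \<and> \<beta> \<prec> \<gamma>}"
  have "wf r"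
    using iffD1[OF wfp_on_iff_wfp wfp_on_wf_part[of Y]] unfolding wfp_def r_def
    by (rule back_subst[of wf]) auto
  then have "wf (mult r)" by (rule wf_mult)
  then show ?thesis using assms(2,3)
  proof (induction A rule: wf_induct_rule)
    case (less A)
    show ?case
    proof (rule wf_partI)
      fix \<beta> assume \<beta>: "\<beta> \<in> Y" "\<beta> \<prec> Sum A"
      then have "\<beta> \<in> OT" using Y by (auto simp: hereditary_def)
      then show "\<beta> \<in> wf_part Y"
      proof (cases "\<beta> \<in> HH")
        case True
        then obtain \<alpha> where "\<alpha> \<in># A" "\<beta> = \<alpha> \<or> \<beta> \<prec> \<alpha>" using \<beta>(2) by (auto simp: less_Sum_right)
        then show ?thesis using less.prems(2) \<beta>(1) wf_part_downward by blast
      next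
        case False
        then obtain B where B: "\<beta> = Sum B" using \<open>\<beta> \<in> OT\<close> by (auto simp: in_HH_iff)
        then obtain a where a: "a \<in># A - B" "\<forall>b\<in>#B - A. b \<prec> a" using \<beta>(2) by auto
        have aw: "a \<in> wf_part Y" using a(1) less.prems(2) by (auto dest: in_diffD)
        have diff: "b \<in> wf_part Y" if "b \<in># B - A" for b
          using that a(2) aw wf_part_downward[of a Y b] hereditaryD(2)[OF Y, of B b] \<beta>(1) B
          by (auto dest: in_diffD)
        have "b \<in> wf_part Y" if "b \<in># B" for b
          using that diff[of b] less.prems(2) by (cases "b \<in># A") (auto simp: in_diff_count not_in_iff)
        then have Bw: "set_mset B \<subseteq> wf_part Y" by blast
        \<comment> \<open>The common part stays fixed while \<open>A - B\<close> is replaced by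
          elements below one of its members.\<close>
        have "(A \<inter># B + (B - A), A \<inter># B + (A - B)) \<in> mult r"
          using a diff aw by (intro one_step_implies_mult) (auto simp: r_def)
        moreover have "A \<inter># B + (B - A) = B" "A \<inter># B + (A - B) = A"
          by (auto simp: multiset_eq_iff)
        ultimately have "(B, A) \<in> mult r" by simp
        then show ?thesis using less.IH Bw \<beta>(1) B by blast
      qed
    qed (use less.prems in blast)
  qed
qed

text \<open>Outer induction on the accessible exponent, inner induction on the size of the
  predecessor: sums reduce to summands, powers to a smaller exponent, and an SC-term below
  \<open>Exp \<alpha>\<close> is at most \<open>\<alpha>\<close>.\<close>

lemma Exp_in_wf_part:
  assumes Y: "hereditary Y" and "Exp \<alpha> \<in> Y" "\<alpha> \<in> wf_part Y"
  shows "Exp \<alpha> \<in> wf_part Y"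
  using assms(3,2)
proof (induction rule: wf_part_induct)
  case (less \<alpha>)
  have "\<beta> \<in> wf_part Y" if "\<beta> \<in> Y" "\<beta> \<prec> Exp \<alpha>" for \<beta>
    using that
  proof (induction "size \<beta>" arbitrary: \<beta> rule: less_induct)
    case (less \<beta>)
    then have "\<beta> \<in> OT" using Y by (auto simp: hereditary_def)
    then show ?case
    proof (cases rule: OT_cases)
      case (Sum B)
      have "b \<in> wf_part Y" if "b \<in># B" for b
      proof (rule less.hyps)
        show "size b < size \<beta>" using Sum size_in_Sum[OF that] by simp
        show "b \<in> Y" using hereditaryD(2)[OF Y] less.prems Sum that by blast
        show "b \<prec> Exp \<alpha>" using less.prems Sum that by simp
      qed
      then show ?thesis using Sum_in_wf_part[OF Y] less.prems Sum by (auto simp: subset_iff)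
    next
      case (Exp \<gamma>)
      then show ?thesis using hereditaryD(3)[OF Y] less.prems \<open>\<And>\<beta>. \<beta> \<in> Y \<Longrightarrow> \<beta> \<prec> \<alpha> \<Longrightarrow> Exp \<beta> \<in> Y \<Longrightarrow> Exp \<beta> \<in> wf_part Y\<close>
        by auto
    next
      case SC
      then have "\<beta> = \<alpha> \<or> \<beta> \<prec> \<alpha>" using less.prems(2) by (simp add: less_Exp_right)
      then show ?thesis
        using \<open>\<alpha> \<in> wf_part Y\<close> less.prems(1) wf_part_downward[of \<alpha> Y \<beta>] by auto
    qed
  qed
  then show ?case by (rule wf_partI[OF less.prems])
qed

text \<open>Sums and powers below \<open>\<sigma>\<close> reduce to smaller components below
  \<open>\<sigma>\<close>, so only SC-terms \<open>\<tau>\<close> need an argument. The size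
  hypothesis in \<open>step\<close> serves the critical subterms in the theta case.\<close>

lemma SC_in_wf_part:
  assumes Y: "hereditary Y" and \<sigma>: "\<sigma> \<in> Y" "\<sigma> \<in> SC"
    and step: "\<And>\<tau>. \<tau> \<in> Y \<Longrightarrow> \<tau> \<in> SC \<Longrightarrow> \<tau> \<prec> \<sigma> \<Longrightarrow>
      (\<And>\<beta>. \<beta> \<in> Y \<Longrightarrow> \<beta> \<prec> \<sigma> \<Longrightarrow> size \<beta> < size \<tau> \<Longrightarrow> \<beta> \<in> wf_part Y) \<Longrightarrow> \<tau> \<in> wf_part Y"
  shows "\<sigma> \<in> wf_part Y"
proof (rule wf_partI)
  show "\<beta> \<in> wf_part Y" if "\<beta> \<in> Y" "\<beta> \<prec> \<sigma>" for \<beta>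
    using that
  proof (induction "size \<beta>" arbitrary: \<beta> rule: less_induct)
    case (less \<beta>)
    then have "\<beta> \<in> OT" using Y by (auto simp: hereditary_def)
    then show ?case
    proof (cases rule: OT_cases)
      case (Sum B)
      have "b \<in> wf_part Y" if "b \<in># B" for b
      proof (rule less.hyps)
        show "size b < size \<beta>" using Sum size_in_Sum[OF that] by simp
        show "b \<in> Y" using hereditaryD(2)[OF Y] less.prems Sum that by blast
        show "b \<prec> \<sigma>" using less.prems Sum that \<sigma>(2) SC_in_HH by (auto simp: less_Sum_left)
      qed
      then show ?thesis using Sum_in_wf_part[OF Y] less.prems Sum by (auto simp: subset_iff)
    next
      case (Exp \<gamma>)
      then have "\<gamma> \<in> Y" "\<gamma> \<prec> \<sigma>"
        using less.prems hereditaryD(3)[OF Y] \<sigma>(2) by (auto simp: less_Exp_left)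
      then have "\<gamma> \<in> wf_part Y" using less.hyps Exp by simp
      then show ?thesis using Exp_in_wf_part[OF Y] less.prems Exp by auto
    next
      case SC
      then show ?thesis using less step by blast
    qed
  qed
qed (rule \<sigma>)

lemma wf_part_eq_if_wfp_on_SC:
  assumes Y: "hereditary Y" and wf: "wfp_on (Y \<inter> SC) (\<prec>)"
  shows "wf_part Y = Y"
proof (rule antisym[OF wf_part_subset subsetI])
  have SC: "\<sigma> \<in> wf_part Y" if "\<sigma> \<in> Y \<inter> SC" for \<sigma>
    using wf that by (induction rule: wfp_on_induct) (use SC_in_wf_part[OF Y] that in blast)+
  show "\<alpha> \<in> wf_part Y" if "\<alpha> \<in> Y" for \<alpha>
    using that
  proof (induction "size \<alpha>" arbitrary: \<alpha> rule: less_induct)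
    case (less \<alpha>)
    then have "\<alpha> \<in> OT" using Y by (auto simp: hereditary_def)
    then show ?case
    proof (cases rule: OT_cases)
      case (Sum A)
      have "a \<in> wf_part Y" if "a \<in># A" for a
        using that less Sum size_in_Sum[OF that] hereditaryD(2)[OF Y] by auto
      then show ?thesis using Sum_in_wf_part[OF Y] less.prems Sum by (auto simp: subset_iff)
    next
      case (Exp \<beta>)
      then show ?thesis using Exp_in_wf_part[OF Y] less hereditaryD(3)[OF Y] by auto
    next
      case SC
      then show ?thesis using less.prems \<open>\<And>\<sigma>. \<sigma> \<in> Y \<inter> SC \<Longrightarrow> \<sigma> \<in> wf_part Y\<close> by blast
    qed
  qed
qed

text \<open>Below a minimal element \<open>a\<close> of \<open>Q \<inter> A\<close>, all of
  \<open>Q\<close> lies in \<open>B\<close>; a minimal element there is minimal in \<open>Q\<close>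
  by transitivity.\<close>

lemma wfp_on_Un:
  assumes "transp_on (A \<union> B) R" "wfp_on A R" "wfp_on B R"
  shows "wfp_on (A \<union> B) R"
  unfolding wfp_on_iff_ex_minimal
proof (intro allI impI)
  fix Q assume Q: "Q \<subseteq> A \<union> B" "Q \<noteq> {}"
  show "\<exists>z\<in>Q. \<forall>y. R y z \<longrightarrow> y \<notin> Q"
  proof (cases "Q \<inter> A = {}")
    case True
    then have "Q \<subseteq> B" using Q by blast
    then show ?thesis using assms(3) Q(2) by (simp add: wfp_on_iff_ex_minimal)
  next
    case False
    then obtain a where a: "a \<in> Q \<inter> A" "\<And>y. R y a \<Longrightarrow> y \<notin> Q \<inter> A"
      using assms(2) unfolding wfp_on_iff_ex_minimal by (metis Int_lower2)
    show ?thesis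
    proof (cases "{b \<in> Q. R b a} = {}")
      case True
      then show ?thesis using a(1) by blast
    next
      case False
      moreover have "{b \<in> Q. R b a} \<subseteq> B" using a Q by blast
      ultimately obtain b where b: "b \<in> Q" "R b a" "\<And>y. R y b \<Longrightarrow> \<not> (y \<in> Q \<and> R y a)"
        using assms(3) unfolding wfp_on_iff_ex_minimal
        by (metis (mono_tags, lifting) mem_Collect_eq)
      then have "y \<notin> Q" if "R y b" for y
        using that a(1) Q(1) assms(1) by (metis IntD1 subsetD transp_onD)
      then show ?thesis using b(1) by blast
    qed
  qed
qed

lemma wfp_on_UN:
  assumes "finite I" "transp_on (\<Union>i\<in>I. A i) R" "\<And>i. i \<in> I \<Longrightarrow> wfp_on (A i) R"
  shows "wfp_on (\<Union>i\<in>I. A i) R"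
  using assms
proof (induction I rule: finite_induct)
  case empty
  then show ?case by (simp add: wfp_on_def)
next
  case (insert i I)
  then have "wfp_on (\<Union>i\<in>I. A i) R"
    by (intro insert.IH) (auto intro: transp_on_subset)
  then show ?case using insert.prems wfp_on_Un[of "A i" "\<Union>i\<in>I. A i" R] by simp
qed

section \<open>Largest cardinalities and normalization\<close>

lemma FC_sup_eq_None_iff: "FC_sup J \<alpha> = None \<longleftrightarrow> FC J \<alpha> = {}"
  by (simp add: FC_sup_def)

lemma FC_sup_eq_Some_iff:
  "FC_sup J \<alpha> = Some s \<longleftrightarrow> s \<in> FC J \<alpha> \<and> (\<forall>x\<in>FC J \<alpha>. x \<le> s)"
proof (cases "FC J \<alpha> = {}")
  case False
  then show ?thesis by (auto simp: FC_sup_def finite_FC Max_eq_iff)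
qed (simp add: FC_sup_def)

lemma FC_sup_eq_Some_0_iff: "FC_sup 0 \<alpha> = Some 0 \<longleftrightarrow> 0 \<in> FC 0 \<alpha>"
  by (auto simp: FC_sup_eq_Some_iff dest: FC_nonpos)

lemma shift_closed: "FC J \<alpha> = {} \<Longrightarrow> shift J k \<alpha> = \<alpha>"
proof (induction \<alpha> arbitrary: J)
  case (Sum A)
  then show ?case by (simp add: image_mset_cong[where g = "\<lambda>x. x"])
qed (auto split: if_splits)

lemma star_closed: "FC 0 \<alpha> = {} \<Longrightarrow> star \<alpha> = \<alpha>"
  by (simp add: star_def FC_sup_def)

lemma star_top: "0 \<in> FC 0 \<alpha> \<Longrightarrow> star \<alpha> = \<alpha>"
  using FC_sup_eq_Some_0_iff[of \<alpha>] by (simp add: star_def)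

lemma star_shift:
  assumes "FC_sup 0 \<alpha> = Some s"
  shows "star \<alpha> = shift 0 (- s) \<alpha>" "shiftable 0 (- s) \<alpha>"
  using assms by (simp add: star_def) (use assms in \<open>auto simp: FC_sup_eq_Some_iff shiftable_def\<close>)

lemma size_star: "size (star \<alpha>) = size \<alpha>"
  by (auto simp: star_def size_shift split: option.split)

lemma star_OT: "\<alpha> \<in> OT \<Longrightarrow> star \<alpha> \<in> OT"
  by (cases "FC_sup 0 \<alpha>") (auto simp: star_shift shift_OT FC_sup_eq_None_iff star_closed)

lemma zero_in_FC_star:
  assumes "FC 0 \<alpha> \<noteq> {}"
  shows "0 \<in> FC 0 (star \<alpha>)"
proof -
  obtain s where s: "FC_sup 0 \<alpha> = Some s" using assms by (simp add: FC_sup_def)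
  then show ?thesis
    using FC_shift_same[OF star_shift(2)[OF s]] by (force simp: star_shift(1) FC_sup_eq_Some_iff)
qed

lemma FC_star_lower:
  assumes "\<And>y. y \<in> FC 0 \<alpha> \<Longrightarrow> c < y" "x \<in> FC 0 (star \<alpha>)"
  shows "c < x"
proof (cases "FC_sup 0 \<alpha>")
  case None
  then show ?thesis using assms by (auto simp: FC_sup_eq_None_iff star_closed)
next
  case (Some s)
  then have "s \<le> 0" using FC_nonpos by (auto simp: FC_sup_eq_Some_iff)
  then show ?thesis
    using FC_shift_same[OF star_shift(2)[OF Some]] assms by (fastforce simp: star_shift(1)[OF Some])
qed

text \<open>A shift by \<open>k\<close> moves the largest cardinality by \<open>k\<close>, and
  \<open>star\<close> takes it off again.\<close>

lemma star_shift_eq: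
  assumes "shiftable 0 k \<alpha>"
  shows "star (shift 0 k \<alpha>) = star \<alpha>"
proof (cases "FC_sup 0 \<alpha>")
  case None
  then have "FC 0 \<alpha> = {}" by (simp add: FC_sup_eq_None_iff)
  then show ?thesis by (simp add: shift_closed)
next
  case (Some s)
  then have "FC_sup 0 (shift 0 k \<alpha>) = Some (s + k)"
    using FC_shift_same[OF assms] by (auto simp: FC_sup_eq_Some_iff)
  then show ?thesis
    using shift_shift_same[OF assms, of "- (s + k)"] Some by (simp add: star_shift(1))
qed

text \<open>With only negative cardinalities, the term itself is what gets collected. So a condition
  on its critical subterms is one on its own normal form.\<close>

lemma KK_SC_low:
  assumes "\<sigma> \<in> SC" "0 \<notin> FC 0 \<sigma>"
  shows "KK 0 \<sigma> = {shift 0 1 \<sigma>}" "shiftable 0 1 \<sigma>"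
proof -
  have neg: "x < 0" if "x \<in> FC 0 \<sigma>" for x
    using FC_nonpos[OF that] assms(2) that by (cases "x = 0") auto
  then show "shiftable 0 1 \<sigma>" by (force simp: shiftable_def)
  have "FC_sup 0 \<sigma> < Some 0" using neg by (simp add: FC_sup_less_Some)
  then show "KK 0 \<sigma> = {shift 0 1 \<sigma>}"
    using assms by (cases \<sigma> rule: oterm.exhaust) (auto simp del: shift.simps(4) split: if_splits)
qed

text \<open>The comparison descends through summands, exponents and critical subterms to the free
  Omega symbols; \<open>FC_KK\<close> accounts for the theta case.\<close>

lemma Omega_le_iff:
  assumes "\<alpha> \<in> OT"
  shows "Omega J = \<alpha> \<or> Omega J \<prec> \<alpha> \<longleftrightarrow> (\<exists>x\<in>FC 0 \<alpha>. J \<le> x)"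
  using assms
proof (induction "size \<alpha>" arbitrary: \<alpha> rule: less_induct)
  case less
  show ?case
  proof (cases \<alpha> rule: oterm.exhaust)
    case (Sum A)
    have "Omega J = a \<or> Omega J \<prec> a \<longleftrightarrow> (\<exists>x\<in>FC 0 a. J \<le> x)" if "a \<in># A" for a
      using less.hyps[of a] Sum_memD[of A a] that Sum less.prems by simp
    then show ?thesis using Sum by auto
  next
    case (Theta b)
    have "Omega J = c \<or> Omega J \<prec> c \<longleftrightarrow> (\<exists>x\<in>FC 0 c. J \<le> x)" if "c \<in> KK 0 b" for c
      using less.hyps[of c] KK_memD[of b c] that Theta less.prems by simp
    moreover have "FC 0 \<alpha> = (\<Union>c\<in>KK 0 b. FC 0 c)" using FC_KK[of 0 b] Theta by simp
    ultimately show ?thesis using Theta by auto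
  qed (use less in auto)
qed

text \<open>A cardinality \<open>x\<close> is witnessed by \<open>Omega x\<close> lying at or below
  the term, and transitivity carries this over to \<open>\<beta>\<close>.\<close>

lemma less_FC:
  assumes "\<alpha> \<in> OT" "\<beta> \<in> OT" "\<alpha> \<prec> \<beta>" "x \<in> FC 0 \<alpha>"
  shows "\<exists>y\<in>FC 0 \<beta>. x \<le> y"
proof -
  have "Omega x \<in> OT" using FC_nonpos[OF assms(4)] by simp
  moreover have "Omega x = \<alpha> \<or> Omega x \<prec> \<alpha>" using iffD2[OF Omega_le_iff[OF assms(1)]] assms(4) by blast
  ultimately have "Omega x \<prec> \<beta>" using assms(1-3) less_trans_OT by blast
  then show ?thesis using iffD1[OF Omega_le_iff[OF assms(2)]] by blast
qed

section \<open>The levels\<close>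

fun idx :: "nat \<Rightarrow> nat option" where
  "idx 0 = None"
| "idx (Suc n) = Some n"

lemma idx_surj: "\<exists>m. c = idx m"
  by (cases c) (metis idx.simps)+

text \<open>The strict bound forbids all cardinalities for \<open>m = 0\<close> and means
  \<open>x \<ge> - n\<close> for \<open>m = n + 1\<close>. The guard \<open>0 < m\<close> matters
  because a closed theta-term is its own critical subterm, which the empty union could not
  contain.\<close>

definition level :: "nat \<Rightarrow> oterm set" where
  "level m = {\<beta> \<in> OT. (\<forall>x\<in>FC 0 \<beta>. - int m < x) \<and>
     (0 < m \<longrightarrow> star ` KK 0 \<beta> \<subseteq> (\<Union>i<m. Acc (idx i)))}"

definition top_at :: "nat \<Rightarrow> oterm \<Rightarrow> bool" where
  "top_at m \<beta> \<longleftrightarrow> m = 0 \<or> 0 \<in> FC 0 \<beta>"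

lemma lessThan_Some_eq: "{..<Some n} = idx ` {..<Suc n}"
proof -
  have "x \<in> {..<Some n} \<longleftrightarrow> x \<in> insert None (Some ` {..<n})" for x
    by (cases x) auto
  then have "{..<Some n} = insert None (Some ` {..<n})" by blast
  then show ?thesis by (simp add: lessThan_Suc_eq_insert_0 image_image)
qed

lemma MM_idx: "MM (idx m) = {\<beta> \<in> level m. top_at m \<beta>}"
proof (cases m)
  case 0
  then show ?thesis using FC_nonpos by (force simp: level_def top_at_def FC_sup_eq_None_iff)
next
  case (Suc n)
  have GG: "Some (- int n) \<le> GG \<beta> \<longleftrightarrow> (\<forall>x\<in>FC 0 \<beta>. - int m < x)" if "0 \<in> FC 0 \<beta>" for \<beta>
  proof -
    have "FC 0 \<beta> \<noteq> {}" using that by auto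
    then show ?thesis using Suc by (auto simp: GG_def finite_FC)
  qed
  have "(\<Union>i\<in>{..<Some n}. wf_part (MM i)) = (\<Union>i<m. Acc (idx i))"
    unfolding lessThan_Some_eq Suc by (simp add: Acc_def)
  then show ?thesis
    using GG Suc by (auto simp: level_def top_at_def FC_sup_eq_Some_0_iff)
qed

lemma level_OT: "\<alpha> \<in> level m \<Longrightarrow> \<alpha> \<in> OT"
  by (simp add: level_def)

lemma hereditary_level: "hereditary (level m)"
  by (fastforce simp: hereditary_def level_def OT_Sum_iff intro: HH_in_OT)

lemma hereditary_level_low: "hereditary {\<beta> \<in> level m. \<not> top_at m \<beta>}"
  using hereditary_level[of m] by (fastforce simp: hereditary_def top_at_def)

text \<open>Call a term low if it is not \<open>top_at m\<close>. Among terms with the same largest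
  cardinality \<open>star\<close> is one fixed shift, hence strictly monotone, and pulls
  well-foundedness back from an accessible set.\<close>

lemma wfp_on_low_SC: "wfp_on ({\<beta> \<in> level m. \<not> top_at m \<beta>} \<inter> SC) (\<prec>)"
proof -
  \<comment> \<open>Pieces are indexed by the accessible set containing the normal form and by the
    largest cardinality, for which the level leaves finitely many values.\<close>
  define X where "X = (\<lambda>(i, s). {\<sigma> \<in> OT. star \<sigma> \<in> Acc (idx i) \<and> FC_sup 0 \<sigma> = s})"
  define I where "I = {..<m} \<times> insert None (Some ` {- int m..0})"
  have "wfp_on (\<Union>p\<in>I. X p) (\<prec>)"
  proof (rule wfp_on_UN)
    show "finite I" by (simp add: I_def)
    show "transp_on (\<Union>p\<in>I. X p) (\<prec>)"
      by (auto simp: X_def transp_on_def intro: less_trans_OT)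
    show "wfp_on (X p) (\<prec>)" for p
    proof -
      obtain i s where p: "p = (i, s)" by (cases p)
      show ?thesis
      proof (rule wfp_on_mono_stronger[where f = star])
        show "wfp_on (Acc (idx i)) (\<prec>)" unfolding Acc_def by (rule wfp_on_wf_part)
        show "star ` X p \<subseteq> Acc (idx i)" by (auto simp: X_def p)
        show "star \<alpha> \<prec> star \<beta>" if "\<alpha> \<in> X p" "\<beta> \<in> X p" "\<alpha> \<prec> \<beta>" for \<alpha> \<beta>
        proof (cases s)
          case None
          then show ?thesis using that by (simp add: X_def p FC_sup_eq_None_iff star_closed)
        next
          case (Some x)
          then show ?thesis
            using that shift_less[of \<alpha> \<beta> 0 "- x"] by (simp add: X_def p star_shift)
        qed
      qed
    qed
  qed
  moreover have "{\<beta> \<in> level m. \<not> top_at m \<beta>} \<inter> SC \<subseteq> (\<Union>p\<in>I. X p)"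
  proof
    fix \<sigma> assume \<sigma>: "\<sigma> \<in> {\<beta> \<in> level m. \<not> top_at m \<beta>} \<inter> SC"
    \<comment> \<open>The only critical subterm of \<open>\<sigma>\<close> is
      \<open>\<sigma>\<close> shifted by 1, which has the same normal form.\<close>
    then have "star (shift 0 1 \<sigma>) \<in> (\<Union>i<m. Acc (idx i))" and "shiftable 0 1 \<sigma>"
      using KK_SC_low[of \<sigma>] by (auto simp: level_def top_at_def)
    then obtain i where i: "i < m" "star \<sigma> \<in> Acc (idx i)" by (auto simp: star_shift_eq)
    have "FC_sup 0 \<sigma> \<in> insert None (Some ` {- int m..0})"
      using \<sigma> FC_nonpos[of _ 0 \<sigma>]
      by (cases "FC_sup 0 \<sigma>") (force simp: FC_sup_eq_Some_iff level_def)+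
    then show "\<sigma> \<in> (\<Union>p\<in>I. X p)" using i \<sigma> by (auto simp: X_def I_def level_def)
  qed
  ultimately show ?thesis by (rule wfp_on_subset)
qed

section \<open>The accessible part of a level\<close>

lemma less_top_at:
  assumes "\<alpha> \<in> OT" "\<beta> \<in> OT" "\<alpha> \<prec> \<beta>" "top_at m \<alpha>"
  shows "top_at m \<beta>"
  using less_FC[OF assms(1-3), of 0] assms(4) FC_nonpos[of _ 0 \<beta>]
  by (force simp: top_at_def)

text \<open>Low terms form an initial segment of the level, so accessibility among them is
  accessibility in the level.\<close>

lemma low_in_wf_part:
  assumes "\<beta> \<in> level m" "\<not> top_at m \<beta>"
  shows "\<beta> \<in> wf_part (level m)"
proof -
  let ?L = "{\<beta> \<in> level m. \<not> top_at m \<beta>}"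
  have "\<beta> \<in> wf_part ?L"
    using wf_part_eq_if_wfp_on_SC[OF hereditary_level_low wfp_on_low_SC, of m] assms by simp
  then show ?thesis
  proof (induction rule: wf_part_induct)
    case (less \<beta>)
    then have \<beta>: "\<beta> \<in> ?L" using wf_part_subset by blast
    show ?case
    proof (rule wf_partI)
      fix \<gamma> assume \<gamma>: "\<gamma> \<in> level m" "\<gamma> \<prec> \<beta>"
      then have "\<gamma> \<in> ?L" using less_top_at[of \<gamma> \<beta> m] \<beta> level_OT by blast
      then show "\<gamma> \<in> wf_part (level m)" using less.IH \<gamma> by blast
    qed (use \<beta> in simp)
  qed
qed

text \<open>Passing from \<open>MM (idx m)\<close> to \<open>level m\<close> adds only low terms as
  predecessors, and these are all accessible.\<close>

lemma Acc_idx: "Acc (idx m) = {\<beta> \<in> wf_part (level m). top_at m \<beta>}"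
proof (intro equalityI subsetI)
  fix \<beta> assume "\<beta> \<in> Acc (idx m)"
  then have "\<beta> \<in> wf_part (MM (idx m))" by (simp add: Acc_def)
  then show "\<beta> \<in> {\<beta> \<in> wf_part (level m). top_at m \<beta>}"
  proof (induction rule: wf_part_induct)
    case (less \<beta>)
    then have \<beta>: "\<beta> \<in> level m" "top_at m \<beta>" using wf_part_subset MM_idx by blast+
    have "\<gamma> \<in> wf_part (level m)" if "\<gamma> \<in> level m" "\<gamma> \<prec> \<beta>" for \<gamma>
      using that less.IH[of \<gamma>] low_in_wf_part[of \<gamma> m] by (cases "top_at m \<gamma>") (auto simp: MM_idx)
    then show ?case using \<beta> wf_partI by blast
  qed
next
  fix \<beta> assume "\<beta> \<in> {\<beta> \<in> wf_part (level m). top_at m \<beta>}"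
  then have "\<beta> \<in> wf_part (level m)" "top_at m \<beta>" by auto
  then have "\<beta> \<in> wf_part (MM (idx m))"
  proof (induction rule: wf_part_induct)
    case (less \<beta>)
    then have "\<beta> \<in> MM (idx m)" using wf_part_subset MM_idx by blast
    then show ?case by (rule wf_partI) (use less.IH MM_idx in blast)
  qed
  then show "\<beta> \<in> Acc (idx m)" by (simp add: Acc_def)
qed

text \<open>Critical subterms that are \<open>top_at m\<close> equal their normal forms and lie in
  the new set \<open>Acc (idx m)\<close>. The others are low SC-terms, whose membership in
  \<open>level m\<close> already puts their normal forms into earlier sets.\<close>

lemma level_SucI:
  assumes "\<beta> \<in> OT" "\<And>x. x \<in> FC 0 \<beta> \<Longrightarrow> - int (Suc m) < x" "KK 0 \<beta> \<subseteq> wf_part (level m)"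
  shows "\<beta> \<in> level (Suc m)"
proof -
  have "star \<gamma> \<in> (\<Union>i<Suc m. Acc (idx i))" if \<gamma>: "\<gamma> \<in> KK 0 \<beta>" for \<gamma>
  proof (cases "top_at m \<gamma>")
    case True
    have *: "\<gamma> \<in> level m" using \<gamma> assms(3) wf_part_subset by blast
    have "star \<gamma> = \<gamma>"
    proof (cases "0 \<in> FC 0 \<gamma>")
      case False
      then have "m = 0" using True by (simp add: top_at_def)
      then have "FC 0 \<gamma> = {}" using * FC_nonpos[of _ 0 \<gamma>] by (force simp: level_def)
      then show ?thesis by (rule star_closed)
    qed (rule star_top)
    then show ?thesis using True \<gamma> assms(3) by (auto simp: Acc_idx)
  next
    case False
    have "\<gamma> \<in> level m" "\<gamma> \<in> SC" using \<gamma> assms wf_part_subset KK_SC[of 0 \<beta> \<gamma>] by auto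
    then have "star (shift 0 1 \<gamma>) \<in> (\<Union>i<m. Acc (idx i))" "shiftable 0 1 \<gamma>"
      using False KK_SC_low[of \<gamma>] by (auto simp: level_def top_at_def)
    then show ?thesis by (auto simp: star_shift_eq less_Suc_eq)
  qed
  then show ?thesis using assms(1,2) by (auto simp: level_def)
qed

section \<open>Closure of the accessible part under theta\<close>

lemma KK_subset_level:
  assumes "Theta \<alpha> \<in> level m" "top_at m (Theta \<alpha>)"
  shows "KK 0 \<alpha> \<subseteq> level m"
proof
  fix \<gamma> assume \<gamma>: "\<gamma> \<in> KK 0 \<alpha>"
  have "\<gamma> \<in> OT" using KK_OT \<gamma> assms(1) level_OT by fastforce
  moreover have "FC 0 \<gamma> \<subseteq> FC 0 (Theta \<alpha>)" using FC_KK[of 0 \<alpha>] \<gamma> by auto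
  \<comment> \<open>For \<open>0 < m\<close>, cardinality 0 keeps the theta-term from being its own
    critical subterm, so its critical subterms are those of \<open>\<alpha>\<close> below
    \<open>- 1\<close>.\<close>
  moreover have "KK 0 \<gamma> \<subseteq> KK 0 (Theta \<alpha>)" if "0 < m"
  proof -
    have "\<not> FC_sup 0 (Theta \<alpha>) < Some 0"
      using that assms(2) by (auto simp: top_at_def FC_sup_less_Some simp del: FC.simps)
    then show ?thesis using KK_KK[of 0 \<gamma> \<alpha>] \<gamma> by simp
  qed
  ultimately show "\<gamma> \<in> level m" using assms(1) unfolding level_def by blast
qed

lemma Theta_in_level_Suc:
  assumes "Theta \<alpha> \<in> level m" "KK 0 \<alpha> \<subseteq> wf_part (level m)"
  shows "\<alpha> \<in> level (Suc m)"
proof (rule level_SucI)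
  show "\<alpha> \<in> OT" using level_OT[OF assms(1)] by simp
  fix x assume x: "x \<in> FC 0 \<alpha>"
  show "- int (Suc m) < x"
  proof (cases "x = 0")
    case False
    \<comment> \<open>Theta hides cardinality 0 of its argument and raises the others by one; this
      is the step from \<open>m\<close> to \<open>m + 1\<close>.\<close>
    then have "x + 1 \<in> FC (0 - 1) \<alpha>"
      using FC_nonpos[OF x] x FC_lower_level[of 1 0 \<alpha>] by auto
    then show ?thesis using assms(1) by (auto simp: level_def)
  qed simp
qed (rule assms(2))

lemma Theta_in_wf_part:
  assumes "\<alpha> \<in> wf_part (level (Suc m))" "KK 0 \<alpha> \<subseteq> wf_part (level m)"
    "Theta \<alpha> \<in> level m" "top_at m (Theta \<alpha>)"
  shows "Theta \<alpha> \<in> wf_part (level m)"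
  using assms
proof (induction rule: wf_part_induct)
  case (less \<alpha>)
  show ?case
  proof (rule SC_in_wf_part[OF hereditary_level])
    show "Theta \<alpha> \<in> SC" using level_OT[OF less.prems(2)] by simp
    fix \<tau>
    assume \<tau>: "\<tau> \<in> level m" "\<tau> \<in> SC" "\<tau> \<prec> Theta \<alpha>"
      and IH: "\<And>\<beta>. \<beta> \<in> level m \<Longrightarrow> \<beta> \<prec> Theta \<alpha> \<Longrightarrow> size \<beta> < size \<tau> \<Longrightarrow> \<beta> \<in> wf_part (level m)"
    \<comment> \<open>An Omega below \<open>Theta \<alpha>\<close> falls under the second
      alternative, and so does a theta-term with larger argument.\<close>
    consider "\<not> top_at m \<tau>" | \<gamma> where "\<gamma> \<in> KK 0 \<alpha>" "\<tau> = \<gamma> \<or> \<tau> \<prec> \<gamma>"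
      | \<beta> where "top_at m \<tau>" "\<tau> = Theta \<beta>" "\<beta> \<prec> \<alpha>" "\<forall>\<gamma>\<in>KK 0 \<beta>. \<gamma> \<prec> Theta \<alpha>"
      using \<tau>(2,3) by (cases \<tau> rule: oterm.exhaust) auto
    then show "\<tau> \<in> wf_part (level m)"
    proof cases
      case 1
      then show ?thesis using low_in_wf_part \<tau>(1) by blast
    next
      case 2
      then show ?thesis using less.prems(1) wf_part_downward \<tau>(1) by blast
    next
      case 3
      \<comment> \<open>These terms lie below \<open>Theta \<alpha>\<close> and are smaller than
        \<open>\<tau>\<close>, so the size hypothesis applies; then \<open>\<beta>\<close> belongs
        to the next level, where the induction on \<open>\<alpha>\<close> takes over.\<close>
      have "KK 0 \<beta> \<subseteq> wf_part (level m)"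
      proof
        fix \<gamma> assume \<gamma>: "\<gamma> \<in> KK 0 \<beta>"
        then show "\<gamma> \<in> wf_part (level m)"
          using KK_subset_level[of \<beta> m] 3 \<tau>(1) size_KK[OF \<gamma>] by (intro IH) auto
      qed
      moreover have "\<beta> \<in> level (Suc m)"
        using Theta_in_level_Suc[of \<beta> m] calculation 3(2) \<tau>(1) by simp
      ultimately show ?thesis using less.IH[of \<beta>] 3 \<tau>(1) by simp
    qed
  qed (rule less.prems)
qed

text \<open>A term with cardinality 0 is at least \<open>Omega 0\<close>, so everything below is
  low.\<close>

lemma Omega_0_in_wf_part:
  assumes "Omega 0 \<in> level m"
  shows "Omega 0 \<in> wf_part (level m)"
proof (rule SC_in_wf_part[OF hereditary_level assms])
  fix \<tau> assume \<tau>: "\<tau> \<in> level m" "\<tau> \<prec> Omega 0"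
  have "\<not> top_at m \<tau>"
  proof
    assume "top_at m \<tau>"
    moreover have "m \<noteq> 0" using assms by (auto simp: level_def)
    ultimately have "Omega 0 = \<tau> \<or> Omega 0 \<prec> \<tau>"
      using Omega_le_iff[of \<tau> 0] level_OT[OF \<tau>(1)] by (auto simp: top_at_def)
    then show False
      using \<tau> less_trans_OT[of "Omega 0" \<tau> "Omega 0"] level_OT[OF \<tau>(1)] less_irrefl by auto
  qed
  then show "\<tau> \<in> wf_part (level m)" using \<tau>(1) low_in_wf_part by blast
qed simp

text \<open>No condition on critical subterms is assumed: their normal forms are smaller than
  \<open>\<alpha>\<close>, so the induction, run for all \<open>m\<close> at once, supplies it
  before the shape of \<open>\<alpha>\<close> is examined.\<close>

lemma top_in_wf_part_level:
  assumes "\<alpha> \<in> OT" "\<And>x. x \<in> FC 0 \<alpha> \<Longrightarrow> - int m < x" "top_at m \<alpha>"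
  shows "\<alpha> \<in> wf_part (level m)"
  using assms
proof (induction "size \<alpha>" arbitrary: \<alpha> m rule: less_induct)
  case less
  have "star \<gamma> \<in> (\<Union>i<m. Acc (idx i))" if m: "0 < m" and \<gamma>: "\<gamma> \<in> KK 0 \<alpha>" for \<gamma>
  proof -
    have "0 \<in> FC 0 \<alpha>" using less.prems(3) m by (simp add: top_at_def)
    then have size: "size (star \<gamma>) < size \<alpha>" using size_KK_less \<gamma> by (simp add: size_star)
    have OT: "star \<gamma> \<in> OT" using KK_OT[OF less.prems(1) \<gamma>] by (rule star_OT)
    show ?thesis
    \<comment> \<open>Closed critical subterms go to level 0. The others normalize to largest
      cardinality 0 and fit into level \<open>m - 1\<close>, since passing to critical subterms
      raises cardinalities by one.\<close>
    proof (cases "FC 0 \<gamma> = {}")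
      case True
      then have "star \<gamma> \<in> wf_part (level 0)"
        using less.hyps[OF size OT, of 0] by (simp add: star_closed top_at_def)
      then have "star \<gamma> \<in> Acc (idx 0)" unfolding Acc_idx by (simp add: top_at_def)
      then show ?thesis using m by blast
    next
      case False
      have low: "- int (m - 1) < x" if "x \<in> FC 0 \<gamma>" for x
      proof -
        have "x \<in> FC (0 - 1) \<alpha>" using FC_KK[of 0 \<alpha>] \<gamma> that by auto
        then obtain y where "y \<in> FC 0 \<alpha>" "x = y + 1" using FC_lower_level[of 1 0 \<alpha>] by auto
        then show ?thesis using less.prems(2)[of y] m by simp
      qed
      have top: "top_at (m - 1) (star \<gamma>)" using zero_in_FC_star[OF False] by (simp add: top_at_def)
      have "star \<gamma> \<in> wf_part (level (m - 1))"
        using less.hyps[OF size OT _ top] FC_star_lower[of \<gamma> "- int (m - 1)"] low by blast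
      then have "star \<gamma> \<in> Acc (idx (m - 1))" using top by (simp add: Acc_idx)
      then show ?thesis using m by (intro UN_I[of "m - 1"]) auto
    qed
  qed
  then have level: "\<alpha> \<in> level m" using less.prems by (auto simp: level_def)
  show ?case
  proof (cases \<alpha> rule: oterm.exhaust)
    case (Sum A)
    have "a \<in> wf_part (level m)" if a: "a \<in># A" for a
    proof (cases "top_at m a")
      case True
      show ?thesis
        using Sum_memD[of A a] a less.prems(1,2) Sum True by (intro less.hyps) auto
    next
      case False
      then show ?thesis
        using low_in_wf_part hereditaryD(2)[OF hereditary_level] level a Sum by blast
    qed
    then show ?thesis using Sum_in_wf_part[OF hereditary_level] level Sum by blast
  next
    case (Exp b)
    then have "b \<in> wf_part (level m)" using less.prems by (intro less.hyps) (auto simp: top_at_def)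
    then show ?thesis using Exp_in_wf_part[OF hereditary_level] level Exp by blast
  next
    case (Omega J)
    then have "J = 0" using less.prems by (auto simp: top_at_def split: if_splits)
    then show ?thesis using Omega_0_in_wf_part level Omega by blast
  next
    case (Theta b)
    have KK: "KK 0 b \<subseteq> wf_part (level m)"
    proof
      fix \<gamma> assume \<gamma>: "\<gamma> \<in> KK 0 b"
      then have l: "\<gamma> \<in> level m" using KK_subset_level level Theta less.prems(3) by blast
      show "\<gamma> \<in> wf_part (level m)"
      proof (cases "top_at m \<gamma>")
        case True
        show ?thesis
          using l True size_KK[OF \<gamma>] Theta by (intro less.hyps) (auto simp: level_def)
      qed (rule low_in_wf_part[OF l])
    qed
    have b: "b \<in> level (Suc m)" using Theta_in_level_Suc KK level Theta by blast
    \<comment> \<open>The argument is one level higher but smaller in size, hence the quantification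
      over \<open>m\<close>.\<close>
    have "b \<in> wf_part (level (Suc m))"
    proof (cases "top_at (Suc m) b")
      case True
      show ?thesis using b True Theta by (intro less.hyps) (auto simp: level_def)
    qed (rule low_in_wf_part[OF b])
    then show ?thesis using Theta_in_wf_part KK level less.prems(3) Theta by blast
  qed
qed

section \<open>Conclusion for the accessible sets\<close>

lemma Acc_eq_MM: "Acc (idx m) = MM (idx m)"
proof -
  have "\<alpha> \<in> wf_part (level m)" if "\<alpha> \<in> level m" "top_at m \<alpha>" for \<alpha>
    using that top_in_wf_part_level[of \<alpha> m] by (auto simp: level_def)
  then show ?thesis using wf_part_subset[of "level m"] unfolding Acc_idx MM_idx by blast
qed

theorem mainTheorem5:
  fixes \<alpha> :: oterm
  assumes "\<alpha> \<in> OT"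
  shows "(FC_sup 0 \<alpha> = -\<infinity> \<longrightarrow> star \<alpha> = \<alpha> \<and> \<alpha> \<in> Acc -\<infinity>) \<and>
         (FC_sup 0 \<alpha> > -\<infinity> \<longrightarrow>
            (\<forall>n. Some (- int n) \<le> GG (star \<alpha>) \<longrightarrow> star \<alpha> \<in> Acc (Some n))) \<and>
         (\<forall>c. star \<alpha> \<in> MM c \<longrightarrow> wfp_on {\<beta> \<in> MM c. \<beta> \<prec> star \<alpha>} (\<prec>))"
proof -
  have "\<alpha> \<in> Acc None" "star \<alpha> = \<alpha>" if "FC_sup 0 \<alpha> = None"
    using that assms star_closed Acc_eq_MM[of 0] by (simp_all add: FC_sup_eq_None_iff)
  moreover have "star \<alpha> \<in> Acc (Some n)"
    if "FC_sup 0 \<alpha> > None" and n: "Some (- int n) \<le> GG (star \<alpha>)" for n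
  proof -
    have "FC 0 \<alpha> \<noteq> {}" using that(1) FC_sup_eq_None_iff[of 0 \<alpha>] by auto
    then have 0: "0 \<in> FC 0 (star \<alpha>)" by (rule zero_in_FC_star)
    \<comment> \<open>Index \<open>n\<close> is level \<open>Suc n\<close>: a minimum of at least
      \<open>- n\<close> is a strict bound by \<open>- (n + 1)\<close>.\<close>
    then have "- int (Suc n) < x" if "x \<in> FC 0 (star \<alpha>)" for x
      using n that by (auto simp: GG_def finite_FC split: if_splits)
    then have "star \<alpha> \<in> wf_part (level (Suc n))"
      using 0 star_OT[OF assms] by (intro top_in_wf_part_level) (auto simp: top_at_def)
    then show ?thesis using Acc_idx[of "Suc n"] 0 by (simp add: top_at_def)
  qed
  moreover have "wfp_on {\<beta> \<in> MM c. \<beta> \<prec> star \<alpha>} (\<prec>)" for c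
  proof -
    obtain m where "c = idx m" using idx_surj by blast
    \<comment> \<open>As \<open>Acc c\<close> exhausts \<open>MM c\<close>, the whole set is
      well-founded, not only the part below \<open>star \<alpha>\<close>.\<close>
    then have "wfp_on (MM c) (\<prec>)"
      using wfp_on_wf_part[of "MM c"] Acc_eq_MM[of m] by (simp add: Acc_def)
    then show ?thesis by (rule wfp_on_subset) blast
  qed
  ultimately show ?thesis by blast
qed

end
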